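(* Let $n\ge 2$. A map $\Psi:\mathrm{Conv}(\mathbb{R}^n,\mathbb{R})\to\mathrm{Conv}(\mathbb{R}^n,\mathbb{R})$ is a continuous, dually epi-translation-invariant and $\mathrm{SL}(n,\mathbb{R})$-equivariant valuation if and only if there exist $c\in\mathbb{R}$ and $\nu\in\mathcal{M}_c^+(\mathbb{R})$ with $\int_{\mathbb{R}\setminus\{0\}}|s|^{-1}\,d\nu(s)<\infty$ and $\int_{\mathbb{R}\setminus\{0\}}s^{-1}\,d\nu(s)=0$ such that $$\Psi(f)[x]=c+\int_{\mathbb{R}\setminus\{0\}}\frac{f(sx)-f(0)}{|s|^2}\,d\nu(s),\qquad x\in\mathbb{R}^n,$$ for every $f\in\mathrm{Conv}(\mathbb{R}^n,\mathbb{R})$.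
   Context: $\mathrm{Conv}(\mathbb{R}^n,\mathbb{R})$ is the space of all finite convex functions $f:\mathbb{R}^n\to\mathbb{R}$, with the topology induced by epi-convergence (on this space it coincides with the topology of pointwise convergence and with that of locally uniform convergence); continuity of $\Psi$ is with respect to this topology. $\Psi(f)[x]$ denotes the value of the function $\Psi(f)$ at $x$. $\Psi$ is a valuation if $\Psi(\max\{f,h\})+\Psi(\min\{f,h\})=\Psi(f)+\Psi(h)$ (pointwise maximum, minimum and addition) whenever $f,h,\min\{f,h\}\in\mathrm{Conv}(\mathbb{R}^n,\mathbb{R})$. $\Psi$ is dually epi-translation-invariant if $\Psi(f+\ell)=\Psi(f)$ for all $f\in\mathrm{Conv}(\mathbb{R}^n,\mathbb{R})$ and all affine maps $\ell:\mathbb{R}^n\to\mathbb{R}$. $\Psi$ is $\mathrm{SL}(n,\mathbb{R})$-equivariant if $\Psi(f\circ g)=\Psi(f)\circ g$ for all $f\in\mathrm{Conv}(\mathbb{R}^n,\mathbb{R})$ and $g\in\mathrm{SL}(n,\mathbb{R})$. $\mathcal{M}_c^+(\mathbb{R})$ is the space of non-negative, finite Borel measures on $\mathbb{R}$ with compact support. *)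

theory Defs
  imports "HOL-Analysis.Analysis"
begin

definition Conv :: "(real ^ 'n \<Rightarrow> real) set" where
  "Conv = {f. convex_on UNIV f}"

definition epi_converges ::
    "(nat \<Rightarrow> (real ^ 'n \<Rightarrow> real)) \<Rightarrow> (real ^ 'n \<Rightarrow> real) \<Rightarrow> bool" where
  "epi_converges F f \<longleftrightarrow> (\<forall>x.
     (\<forall>X. X \<longlonglongrightarrow> x \<longrightarrow> ereal (f x) \<le> liminf (\<lambda>k. ereal (F k (X k)))) \<and>
     (\<exists>X. X \<longlonglongrightarrow> x \<and> (\<lambda>k. F k (X k)) \<longlonglongrightarrow> f x))"

text \<open>
  The topology induced by epi-convergence: its open sets are the subsets of \<^const>\<open>Conv\<close> that
  are sequentially open with respect to epi-convergence inside \<^const>\<open>Conv\<close>.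
\<close>

definition epi_open :: "(real ^ 'n \<Rightarrow> real) set \<Rightarrow> bool" where
  "epi_open U \<longleftrightarrow> U \<subseteq> Conv \<and>
     (\<forall>f\<in>U. \<forall>F. range F \<subseteq> Conv \<and> epi_converges F f \<longrightarrow> (\<forall>\<^sub>F k in sequentially. F k \<in> U))"

definition epi_topology :: "(real ^ 'n \<Rightarrow> real) topology" where
  "epi_topology = topology epi_open"

lemma istopology_epi_open: "istopology epi_open"
  unfolding istopology_def
proof (intro conjI allI impI)
  fix S T :: "(real ^ 'n \<Rightarrow> real) set"
  assume S: "epi_open S" and T: "epi_open T"
  show "epi_open (S \<inter> T)"
    unfolding epi_open_def
  proof (intro conjI ballI allI impI)
    show "S \<inter> T \<subseteq> Conv" using S by (auto simp: epi_open_def)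
    fix f F assume "f \<in> S \<inter> T" and F: "range F \<subseteq> Conv \<and> epi_converges F f"
    then have "\<forall>\<^sub>F k in sequentially. F k \<in> S" "\<forall>\<^sub>F k in sequentially. F k \<in> T"
      using S T unfolding epi_open_def by blast+
    then show "\<forall>\<^sub>F k in sequentially. F k \<in> S \<inter> T" by eventually_elim simp
  qed
next
  fix K :: "(real ^ 'n \<Rightarrow> real) set set"
  assume K: "\<forall>S\<in>K. epi_open S"
  show "epi_open (\<Union>K)"
    unfolding epi_open_def
  proof (intro conjI ballI allI impI)
    show "\<Union>K \<subseteq> Conv" using K by (auto simp: epi_open_def)
    fix f F assume "f \<in> \<Union>K" and F: "range F \<subseteq> Conv \<and> epi_converges F f"
    then obtain S where S: "S \<in> K" "f \<in> S" by blast
    then have "\<forall>\<^sub>F k in sequentially. F k \<in> S"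
      using K F unfolding epi_open_def by blast
    then show "\<forall>\<^sub>F k in sequentially. F k \<in> \<Union>K"
      by eventually_elim (use S in blast)
  qed
qed

lemma openin_epi_topology: "openin epi_topology U \<longleftrightarrow> epi_open U"
  by (simp add: epi_topology_def topology_inverse'[OF istopology_epi_open])

lemma topspace_epi_topology: "topspace epi_topology = Conv"
proof
  show "topspace epi_topology \<subseteq> Conv"
    by (auto simp: topspace_def openin_epi_topology epi_open_def)
  have "epi_open Conv" by (auto simp: epi_open_def image_subset_iff)
  then show "Conv \<subseteq> topspace epi_topology"
    by (intro openin_subset) (simp add: openin_epi_topology)
qed

definition valuation :: "((real ^ 'n \<Rightarrow> real) \<Rightarrow> (real ^ 'n \<Rightarrow> real)) \<Rightarrow> bool" where
  "valuation \<Psi> \<longleftrightarrow> (\<forall>f\<in>Conv. \<forall>h\<in>Conv. (\<lambda>x. min (f x) (h x)) \<in> Conv \<longrightarrow>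
     (\<forall>x. \<Psi> (\<lambda>y. max (f y) (h y)) x + \<Psi> (\<lambda>y. min (f y) (h y)) x = \<Psi> f x + \<Psi> h x))"

definition dually_epi_translation_invariant ::
    "((real ^ 'n \<Rightarrow> real) \<Rightarrow> (real ^ 'n \<Rightarrow> real)) \<Rightarrow> bool" where
  "dually_epi_translation_invariant \<Psi> \<longleftrightarrow>
     (\<forall>f\<in>Conv. \<forall>L b. linear L \<longrightarrow> \<Psi> (\<lambda>x. f x + (L x + b)) = \<Psi> f)"

definition SL_equivariant :: "((real ^ 'n \<Rightarrow> real) \<Rightarrow> (real ^ 'n \<Rightarrow> real)) \<Rightarrow> bool" where
  "SL_equivariant \<Psi> \<longleftrightarrow>
     (\<forall>f\<in>Conv. \<forall>A :: real ^ 'n ^ 'n. det A = 1 \<longrightarrow>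
        \<Psi> (\<lambda>x. f (A *v x)) = (\<lambda>x. \<Psi> f (A *v x)))"

definition measure_support :: "real measure \<Rightarrow> real set" where
  "measure_support \<nu> = {s. \<forall>U. open U \<and> s \<in> U \<longrightarrow> emeasure \<nu> U > 0}"

definition compactly_supported_measures :: "real measure set" where
  "compactly_supported_measures =
     {\<nu>. sets \<nu> = sets borel \<and> finite_measure \<nu> \<and> compact (measure_support \<nu>)}"

end

theory Submission
  imports Defs "HOL-Probability.Distribution_Functions"
begin

text \<open>
  Fix a unit vector \<open>e\<close>. As \<open>SL(n)\<close> acts transitively on the nonzero vectors, \<open>\<Psi>\<close> is determined by the
  real-valued functional \<open>\<mu> f = \<Psi> f e\<close>. This is a continuous valuation that ignores added affine
  functions, and it is invariant under the stabiliser of \<open>e\<close>, in particular under every shear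
  \<open>z \<mapsto> z + (w \<bullet> z) e\<close> with \<open>w\<close> orthogonal to \<open>e\<close>.

  The shears make \<open>\<mu>\<close> blind to everything off the line through \<open>e\<close>. Suppose that \<open>f \<le> f'\<close> differ only in a
  bounded part of a half space \<open>w \<bullet> z \<ge> b\<close> with \<open>b > 0\<close>. A strong shear moves that part far away, whereas
  \<open>\<mu>\<close> does not notice. There a steep affine function can be added such that the positive parts of both
  functions tend to \<open>0\<close>, while the valuation property preserves the difference \<open>\<mu> f' - \<mu> f\<close>, which
  must therefore vanish (\<open>eq_if_differ_off_axis\<close>). A separation argument then shows that an affine function
  below \<open>f\<close> on the line may be joined to \<open>f\<close> for free, and since a convex function is the supremum of
  countably many affine ones, \<open>\<mu> f\<close> depends only on the restriction of \<open>f\<close> to the line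
  (\<open>eq_if_eq_on_axis\<close>). This step excludes all valuations of higher degree of homogeneity.

  What remains is a valuation on convex functions of one real variable. Cutting a convex function at a
  kink shows that the valuation is additive over piecewise linear functions, hence determined by its
  continuous, compactly supported values \<open>g t\<close> on the hinges \<open>(s - t)\<^sub>+\<close>. The diagonal
  matrices \<open>(t, 1/t, 1, \<dots>)\<close>, which need \<open>n \<ge> 2\<close>, turn the convexity of \<open>\<Psi> f\<close> along the line into the convexity of
  \<open>h x = \<bar>x\<bar> g (1/x)\<close>. The second derivative of \<open>h\<close> is a positive measure; its image under
  \<open>r \<mapsto> 1/r\<close>, with density \<open>\<bar>s\<bar>\<close>, is \<open>\<nu>\<close>. That \<open>h\<close> vanishes near \<open>0\<close> is the compactness
  of the support, that its slopes are bounded is the finiteness of the integral of \<open>1/\<bar>s\<bar>\<close>, and that its two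
  asymptotic slopes are opposite, both coming from \<open>g 0\<close>, is the vanishing of the integral of \<open>1/s\<close>. Both sides of
  the formula are then one-dimensional valuations that agree on hinges, so they agree everywhere
  (\<open>line_valuation.radial_representation\<close>).

  For the converse, a convex function has difference quotients at \<open>0\<close> that are bounded on bounded
  intervals, so the integral converges and passes to limits by dominated convergence. Throughout, the
  topology enters only through the fact that epi-convergence of finite convex functions is pointwise
  convergence (\<open>epi_converges_iff_pointwise\<close>).
\<close>

section \<open>Finite convex functions and epi-convergence\<close>

lemma convex_on_max:
  assumes "convex_on S f" "convex_on S g"
  shows "convex_on S (\<lambda>x. max (f x) (g x))"
proof (rule convex_onI)
  fix t :: real and x y assume *: "0 < t" "t < 1" "x \<in> S" "y \<in> S"
  have "(1 - t) * f x + t * f y \<le> (1 - t) * max (f x) (g x) + t * max (f y) (g y)"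
       "(1 - t) * g x + t * g y \<le> (1 - t) * max (f x) (g x) + t * max (f y) (g y)"
    using * by (auto intro!: add_mono mult_left_mono)
  then show "max (f ((1 - t) *\<^sub>R x + t *\<^sub>R y)) (g ((1 - t) *\<^sub>R x + t *\<^sub>R y))
      \<le> (1 - t) * max (f x) (g x) + t * max (f y) (g y)"
    using convex_onD[OF assms(1), of t x y] convex_onD[OF assms(2), of t x y] * by simp
qed (use assms convex_on_imp_convex in blast)

lemma convex_on_compose_linear:
  assumes "convex_on UNIV f" "linear T"
  shows "convex_on UNIV (\<lambda>x. f (T x))"
  using assms by (auto simp: convex_on_def linear_add linear_scale)

lemma convex_on_linear: "linear T \<Longrightarrow> convex_on UNIV (T :: _ \<Rightarrow> real)"
  by (auto simp: convex_on_def linear_add linear_scale)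

lemma convex_on_affine: "convex_on UNIV (\<lambda>x. a \<bullet> x + b)"
  by (auto simp: convex_on_def inner_add_right algebra_simps simp flip: distrib_right)

lemma convex_on_imp_isCont:
  fixes f :: "'a::euclidean_space \<Rightarrow> real"
  assumes "convex_on UNIV f"
  shows "isCont f x"
  using convex_on_continuous[OF open_UNIV assms] by (simp add: continuous_on_eq_continuous_at)

text \<open>
  Around \<open>x\<close> lies a cube, the convex hull of finitely many points. If these points are moved slightly, their
  hull still contains a ball around \<open>x\<close>: otherwise a hyperplane separates a point near \<open>x\<close> from all
  moved vertices, although some vertex lies far on its other side. Hence values that converge along
  some sequence through each point bound the functions from above near \<open>x\<close>. The hypothesis covers
  pointwise convergence and the recovery sequences of epi-convergence alike.
\<close>

lemma convex_eventually_bounded_above: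
  fixes F :: "nat \<Rightarrow> 'a::euclidean_space \<Rightarrow> real"
  assumes cv: "\<And>k. convex_on UNIV (F k)"
    and rec: "\<And>v. \<exists>X l. X \<longlonglongrightarrow> v \<and> (\<lambda>k. F k (X k)) \<longlonglongrightarrow> l"
  shows "\<exists>M. \<forall>\<^sub>F k in sequentially. \<forall>w\<in>ball x (1/2). F k w \<le> M"
proof -
  obtain S :: "'a set" where S: "finite S"
    "cbox (x - (\<Sum>i\<in>Basis. 1 *\<^sub>R i)) (x + (\<Sum>i\<in>Basis. 1 *\<^sub>R i)) = convex hull S"
    using cube_convex_hull[of 1 x] by auto
  obtain X l where X: "\<And>v. X v \<longlonglongrightarrow> v" "\<And>v. (\<lambda>k. F k (X v k)) \<longlonglongrightarrow> l v"
    using rec by metis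
  define M where "M = (\<Sum>v\<in>S. \<bar>l v\<bar>) + 1"
  have M: "l v < M" if "v \<in> S" for v
    using member_le_sum[of v S "\<lambda>v. \<bar>l v\<bar>"] S(1) that by (auto simp: M_def)
  have "\<forall>\<^sub>F k in sequentially. \<forall>v\<in>S. dist (X v k) v < 1/2 \<and> F k (X v k) < M"
    using M by (intro eventually_ball_finite S(1) ballI eventually_conj tendstoD[OF X(1)]
        order_tendstoD(2)[OF X(2)]) auto
  then have "\<forall>\<^sub>F k in sequentially. \<forall>w\<in>ball x (1/2). F k w \<le> M"
  proof eventually_elim
    case (elim k)
    show ?case
    proof
      fix w assume w: "w \<in> ball x (1/2)"
      let ?V = "(\<lambda>v. X v k) ` S"
      have "w \<in> convex hull ?V"
      proof (rule ccontr)
        assume "w \<notin> convex hull ?V"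
        moreover have "closed (convex hull ?V)"
          using S(1) by (intro compact_imp_closed compact_convex_hull finite_imp_compact) auto
        ultimately obtain a b where ab: "a \<bullet> w < b" "\<And>y. y \<in> convex hull ?V \<Longrightarrow> a \<bullet> y > b"
          using separating_hyperplane_closed_point[of "convex hull ?V" w] by auto
        \<comment> \<open>The point of the cube that is extreme in the direction \<open>- a\<close> shows that some vertex is at
          distance at least \<open>1\<close> from \<open>x\<close> in that direction.\<close>
        have "\<bar>sgn a \<bullet> i\<bar> \<le> 1" if "i \<in> Basis" for i
          using Basis_le_norm[OF that, of "sgn a"] by (auto simp: norm_sgn split: if_splits)
        then have "x - sgn a \<in> convex hull S"
          unfolding S(2)[symmetric] mem_box
          by (auto simp: inner_diff_left inner_add_left inner_sum_left inner_Basis if_distrib abs_le_iff cong: if_cong)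
        moreover have "a \<bullet> (x - sgn a) = a \<bullet> x - norm a"
          by (cases "a = 0") (simp_all add: inner_diff_right sgn_div_norm dot_square_norm power2_eq_square)
        moreover have "convex hull S \<subseteq> {z. a \<bullet> z > a \<bullet> x - norm a}" if "S \<subseteq> {z. a \<bullet> z > a \<bullet> x - norm a}"
          using that by (intro hull_minimal convex_halfspace_gt)
        ultimately obtain v where v: "v \<in> S" "a \<bullet> v \<le> a \<bullet> x - norm a"
          by force
        have "a \<bullet> (X v k - v) \<le> norm a * (1/2)"
          using elim v(1) by (intro order_trans[OF norm_cauchy_schwarz] mult_left_mono) (auto simp: dist_norm less_imp_le)
        moreover have "a \<bullet> (x - w) \<le> norm a * (1/2)"
          using w by (intro order_trans[OF norm_cauchy_schwarz] mult_left_mono) (auto simp: dist_norm less_imp_le)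
        moreover have "a \<bullet> X v k > b"
          using v(1) by (intro ab(2) hull_inc) auto
        ultimately show False
          using ab(1) v(2) by (simp add: inner_diff_right)
      qed
      then show "F k w \<le> M"
        using convex_on_convex_hull_bound[of ?V "F k" M] elim
          convex_on_subset[OF cv] by (auto simp: less_imp_le)
    qed
  qed
  then show ?thesis by blast
qed

text \<open>
  A local upper bound makes a convex function locally Lipschitz: extend the segment from \<open>p\<close> through
  \<open>q\<close> up to length \<open>1/8\<close>, which stays inside the ball.
\<close>

lemma convex_increment_le:
  fixes f :: "'a::real_normed_vector \<Rightarrow> real"
  assumes f: "convex_on UNIV f" and M: "\<And>w. w \<in> ball x (1/2) \<Longrightarrow> f w \<le> M"
    and pq: "p \<in> ball x (1/16)" "q \<in> ball x (1/16)"
  shows "f q \<le> f p + 8 * dist p q * (M - f p)"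
proof (cases "p = q")
  case False
  define z where "z = p + (1 / (8 * dist p q)) *\<^sub>R (q - p)"
  have d: "dist p q > 0" "8 * dist p q \<le> 1"
    using pq False dist_triangle2[of p q x] by (auto simp: dist_commute)
  have "dist p z = 1/8"
    using d by (simp add: z_def dist_norm norm_minus_commute)
  then have "z \<in> ball x (1/2)"
    using dist_triangle[of x z p] pq by auto
  moreover have "(1 - 8 * dist p q) *\<^sub>R p + (8 * dist p q) *\<^sub>R z = q"
    using d by (simp add: z_def algebra_simps)
  ultimately have "f q \<le> (1 - 8 * dist p q) * f p + 8 * dist p q * f z" and "f z \<le> M"
    using convex_onD[OF f, of "8 * dist p q" p z] M[of z] d by auto
  moreover from this(2) have "8 * dist p q * f z \<le> 8 * dist p q * M"
    using d by (intro mult_left_mono) auto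
  ultimately show ?thesis
    by (simp only: right_diff_distrib left_diff_distrib)
qed simp

text \<open>
  All sequences tending to \<open>x\<close> produce the same limit, since the functions are Lipschitz near \<open>x\<close> uniformly in
  \<open>k\<close>.
\<close>

lemma convex_continuous_convergence:
  fixes F :: "nat \<Rightarrow> 'a::euclidean_space \<Rightarrow> real"
  assumes cv: "\<And>k. convex_on UNIV (F k)"
    and rec: "\<And>v. \<exists>X l. X \<longlonglongrightarrow> v \<and> (\<lambda>k. F k (X k)) \<longlonglongrightarrow> l"
    and X: "X \<longlonglongrightarrow> x" "(\<lambda>k. F k (X k)) \<longlonglongrightarrow> l" and Y: "Y \<longlonglongrightarrow> x"
  shows "(\<lambda>k. F k (Y k)) \<longlonglongrightarrow> l"
proof -
  obtain M where M: "\<forall>\<^sub>F k in sequentially. \<forall>w\<in>ball x (1/2). F k w \<le> M"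
    using convex_eventually_bounded_above[of F x] cv rec by auto
  define t where "t k = 8 * dist (X k) (Y k)" for k
  have t: "t \<longlonglongrightarrow> 0"
    unfolding t_def using tendsto_dist[OF X(1) Y] by (auto intro: tendsto_eq_intros)
  have "\<forall>\<^sub>F k in sequentially. X k \<in> ball x (1/16)" "\<forall>\<^sub>F k in sequentially. Y k \<in> ball x (1/16)"
    using tendstoD[OF X(1), of "1/16"] tendstoD[OF Y, of "1/16"] by (auto simp: dist_commute)
  moreover have "\<forall>\<^sub>F k in sequentially. t k < 1"
    using order_tendstoD(2)[OF t] by auto
  ultimately have *: "\<forall>\<^sub>F k in sequentially. F k (Y k) \<le> F k (X k) + t k * (M - F k (X k)) \<and>
        (F k (X k) - t k * M) / (1 - t k) \<le> F k (Y k)"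
    using M
  proof eventually_elim
    case (elim k)
    show ?case
      using convex_increment_le[OF cv, of x k M "X k" "Y k"] convex_increment_le[OF cv, of x k M "Y k" "X k"] elim
      by (auto simp: t_def dist_commute divide_le_eq algebra_simps)
  qed
  have lower: "(\<lambda>k. (F k (X k) - t k * M) / (1 - t k)) \<longlonglongrightarrow> (l - 0 * M) / (1 - 0)"
    by (intro tendsto_intros t X) simp
  have upper: "(\<lambda>k. F k (X k) + t k * (M - F k (X k))) \<longlonglongrightarrow> l + 0 * (M - l)"
    by (intro tendsto_intros t X)
  show ?thesis
    by (rule tendsto_sandwich[OF _ _ lower[simplified] upper[simplified]])
      (rule eventually_mono[OF *], blast)+
qed

theorem epi_converges_iff_pointwise:
  assumes "\<And>k. F k \<in> Conv"
  shows "epi_converges F f \<longleftrightarrow> (\<forall>x. (\<lambda>k. F k x) \<longlonglongrightarrow> f x)"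
proof
  have cv: "convex_on UNIV (F k)" for k
    using assms by (simp add: Conv_def)
  {
    assume "epi_converges F f"
    then have *: "\<exists>X. X \<longlonglongrightarrow> x \<and> (\<lambda>k. F k (X k)) \<longlonglongrightarrow> f x" for x
      unfolding epi_converges_def by blast
    then have **: "\<exists>X l. X \<longlonglongrightarrow> x \<and> (\<lambda>k. F k (X k)) \<longlonglongrightarrow> l" for x
      by blast
    show "\<forall>x. (\<lambda>k. F k x) \<longlonglongrightarrow> f x"
    proof
      fix x
      obtain X where X: "X \<longlonglongrightarrow> x" "(\<lambda>k. F k (X k)) \<longlonglongrightarrow> f x"
        using * by blast
      show "(\<lambda>k. F k x) \<longlonglongrightarrow> f x"
        by (rule convex_continuous_convergence[OF cv ** X tendsto_const])
    qed
  }
  assume pw: "\<forall>x. (\<lambda>k. F k x) \<longlonglongrightarrow> f x"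
  have rec: "\<exists>X l. X \<longlonglongrightarrow> x \<and> (\<lambda>k. F k (X k)) \<longlonglongrightarrow> l" for x
    using pw by (intro exI[of _ "\<lambda>_. x"] exI[of _ "f x"]) simp
  have "liminf (\<lambda>k. ereal (F k (X k))) = ereal (f x)" if "X \<longlonglongrightarrow> x" for X x
  proof -
    have "(\<lambda>k. F k (X k)) \<longlonglongrightarrow> f x"
      by (rule convex_continuous_convergence[OF cv rec tendsto_const _ that]) (use pw in blast)
    then show ?thesis
      by (intro lim_imp_Liminf) auto
  qed
  then show "epi_converges F f"
    using pw unfolding epi_converges_def by (auto intro: tendsto_const)
qed

text \<open>
  Separate the point \<open>(x, f x - \<epsilon>)\<close> from the closed epigraph.
\<close>

lemma convex_affine_minorant:
  fixes f :: "'a::euclidean_space \<Rightarrow> real"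
  assumes f: "convex_on UNIV f" and that: "e > 0"
  shows "\<exists>a b. (\<forall>z. a \<bullet> z + b \<le> f z) \<and> f x - e < a \<bullet> x + b"
proof -
  have cont: "continuous_on UNIV f"
    using convex_on_continuous f by auto
  have "epigraph UNIV f = {z. f (fst z) \<le> snd z}"
    by (auto simp: epigraph_def)
  then have "closed (epigraph UNIV f)"
    by (simp, intro closed_Collect_le continuous_intros continuous_on_compose2[OF cont]) auto
  moreover have "convex (epigraph UNIV f)"
    using f by (simp add: convex_epigraph)
  moreover have "(x, f x - e) \<notin> epigraph UNIV f"
    using that by (simp add: mem_epigraph)
  ultimately obtain p b where p: "p \<bullet> (x, f x - e) < b" "\<forall>z\<in>epigraph UNIV f. p \<bullet> z > b"
    using separating_hyperplane_closed_point by blast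
  obtain a c where pac: "p = (a, c)" by (cases p)
  have 1: "a \<bullet> x + c * (f x - e) < b" and 2: "a \<bullet> z + c * f z > b" for z
    using p by (auto simp: pac epigraph_def)
  have c: "c > 0"
    using 1 2[of x] that by (smt (verit) mult_le_cancel_left)
  show ?thesis
  proof (intro exI conjI allI)
    show "((- 1 / c) *\<^sub>R a) \<bullet> z + b / c \<le> f z" for z
      using 2[of z] c by (simp add: field_simps)
    show "f x - e < ((- 1 / c) *\<^sub>R a) \<bullet> x + b / c"
      using 1 c by (simp add: field_simps)
  qed
qed


lemma convex_countable_affine_minorants:
  fixes f :: "'a::euclidean_space \<Rightarrow> real"
  assumes f: "convex_on UNIV f"
  obtains a b where "\<And>(i::nat) z. a i \<bullet> z + b i \<le> f z"
    "\<And>z e. e > 0 \<Longrightarrow> \<exists>i. f z - e < a i \<bullet> z + b i"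
proof -
  obtain D :: "nat \<Rightarrow> 'a" where D: "\<And>U. open U \<Longrightarrow> U \<noteq> {} \<Longrightarrow> \<exists>i. D i \<in> U"
  proof -
    obtain D :: "'a set" where D: "countable D" "\<And>U. open U \<Longrightarrow> U \<noteq> {} \<Longrightarrow> \<exists>d\<in>D. d \<in> U"
      using countable_dense_setE by metis
    have "D \<noteq> {}"
      using D(2)[of UNIV] by auto
    then have "\<exists>i. from_nat_into D i \<in> U" if "open U" "U \<noteq> {}" for U
      using D(2)[OF that] from_nat_into_surj[OF D(1)] by metis
    then show thesis using that by blast
  qed
  have "\<exists>a b. (\<forall>z. a \<bullet> z + b \<le> f z) \<and> f x - inverse (Suc n) < a \<bullet> x + b" for x n
    using convex_affine_minorant[OF f, of "inverse (Suc n)" x] by simp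
  then obtain a b where ab: "\<And>x n z. a x n \<bullet> z + b x n \<le> f z"
    "\<And>x n. f x - inverse (Suc n) < a x n \<bullet> x + b x n"
    by metis
  show thesis
  proof (rule that[of "\<lambda>i. case prod_decode i of (j, n) \<Rightarrow> a (D j) n" "\<lambda>i. case prod_decode i of (j, n) \<Rightarrow> b (D j) n"])
    show "(case prod_decode i of (j, n) \<Rightarrow> a (D j) n) \<bullet> z + (case prod_decode i of (j, n) \<Rightarrow> b (D j) n) \<le> f z" for i z
      using ab by (simp split: prod.split)
  next
    fix z and e :: real assume e: "e > 0"
    obtain n where n: "inverse (Suc n) < e / 4"
      using reals_Archimedean[of "e / 4"] e by auto
    have cont: "continuous_on UNIV f"
      using convex_on_continuous f by auto
    \<comment> \<open>A minorant that is almost exact at a point \<open>d\<close> near \<open>z\<close> is almost exact at \<open>z\<close>: it is affine, and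
      it is bounded by \<open>f\<close> at the reflection of \<open>z\<close> in \<open>d\<close>.\<close>
    have "open {d. f z - e / 2 < 2 * f d - f (2 *\<^sub>R d - z)}"
      by (intro open_Collect_less continuous_intros continuous_on_compose2[OF cont]) auto
    moreover have "z \<in> {d. f z - e / 2 < 2 * f d - f (2 *\<^sub>R d - z)}"
      using e by (simp add: scaleR_2)
    ultimately obtain j where j: "f z - e / 2 < 2 * f (D j) - f (2 *\<^sub>R D j - z)"
      using D by blast
    define p where "p y = a (D j) n \<bullet> y + b (D j) n" for y
    have "p z = 2 * p (D j) - p (2 *\<^sub>R D j - z)"
      by (simp add: p_def inner_diff_right)
    moreover have "p (2 *\<^sub>R D j - z) \<le> f (2 *\<^sub>R D j - z)" "f (D j) - inverse (Suc n) < p (D j)"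
      using ab unfolding p_def by blast+
    ultimately have "f z - e < a (D j) n \<bullet> z + b (D j) n"
      using j n unfolding p_def[symmetric] by linarith
    then show "\<exists>i. f z - e < (case prod_decode i of (j, n) \<Rightarrow> a (D j) n) \<bullet> z + (case prod_decode i of (j, n) \<Rightarrow> b (D j) n)"
      by (intro exI[of _ "prod_encode (j, n)"]) simp
  qed
qed

section \<open>Shear-invariant valuations see only a line\<close>

text \<open>
  The properties of \<open>f \<mapsto> \<Psi> f e\<close> that survive from the matrix group: only the shears along \<open>e\<close>
  matter here, which leaves the statement meaningful in any Euclidean space.
\<close>

locale shear_invariant_valuation =
  fixes \<mu> :: "('a::euclidean_space \<Rightarrow> real) \<Rightarrow> real" and e :: 'a
  assumes unit: "norm e = 1"
    and valuation: "\<And>f h. convex_on UNIV f \<Longrightarrow> convex_on UNIV h \<Longrightarrow> convex_on UNIV (\<lambda>z. min (f z) (h z)) \<Longrightarrow>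
      \<mu> (\<lambda>z. max (f z) (h z)) + \<mu> (\<lambda>z. min (f z) (h z)) = \<mu> f + \<mu> h"
    and add_affine: "\<And>f a b. convex_on UNIV f \<Longrightarrow> \<mu> (\<lambda>z. f z + (a \<bullet> z + b)) = \<mu> f"
    and continuous: "\<And>F f. (\<And>k. convex_on UNIV (F k)) \<Longrightarrow> convex_on UNIV f \<Longrightarrow>
      (\<And>z. (\<lambda>k. F k z) \<longlonglongrightarrow> f z) \<Longrightarrow> (\<lambda>k. \<mu> (F k)) \<longlonglongrightarrow> \<mu> f"
    and shear: "\<And>f w. convex_on UNIV f \<Longrightarrow> w \<bullet> e = 0 \<Longrightarrow> \<mu> (\<lambda>z. f (z + (w \<bullet> z) *\<^sub>R e)) = \<mu> f"
begin

text \<open>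
  The shear \<open>T k\<close> does not change \<open>\<mu>\<close> but moves the set where \<open>f\<close> and \<open>f'\<close> differ to distance of order
  \<open>k\<close> in the direction \<open>- e\<close>. The affine functions \<open>\<l> k\<close> are negative on large balls around the origin,
  so steeply that the positive parts of \<open>G k\<close> and \<open>G' k\<close> vanish there. On the set where the functions differ
  they are so large that \<open>G k\<close> is nonnegative, and therefore the minimum of \<open>G' k\<close> and the positive part of
  \<open>G k\<close> is the convex function \<open>G k\<close>. The valuation property then reads
  \<open>\<mu> f' - \<mu> f = \<mu> (max 0 (G' k)) - \<mu> (max 0 (G k))\<close>, and the right-hand side tends to \<open>0\<close>.
\<close>

lemma eq_if_differ_off_axis:
  assumes f: "convex_on UNIV f" and f': "convex_on UNIV f'" and le: "\<And>z. f z \<le> f' z"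
    and w: "w \<bullet> e = 0" and b: "b > 0" "\<And>z. f z \<noteq> f' z \<Longrightarrow> b \<le> w \<bullet> z"
    and bdd: "bounded {z. f z \<noteq> f' z}"
  shows "\<mu> f = \<mu> f'"
proof -
  have cont: "continuous_on UNIV f"
    using convex_on_continuous f by auto
  obtain C where C: "C > 0" "\<And>z. f z \<noteq> f' z \<Longrightarrow> norm z \<le> C"
    using bdd unfolding bounded_pos by auto
  obtain M where M: "\<And>z. norm z \<le> C \<Longrightarrow> - M \<le> f z" "0 \<le> M"
  proof -
    have "bounded (f ` cball 0 C)"
      by (intro compact_imp_bounded compact_continuous_image continuous_on_subset[OF cont]) auto
    then obtain M where "M > 0" "\<And>z. norm z \<le> C \<Longrightarrow> \<bar>f z\<bar> \<le> M"
      unfolding bounded_pos by auto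
    then show thesis by (intro that[of M]) (auto simp: abs_le_iff minus_le_iff)
  qed
  define \<kappa> where "\<kappa> k = real (Suc k)" for k
  have \<kappa>: "\<kappa> k > 0" for k by (simp add: \<kappa>_def)
  define T where "T k z = z + ((\<kappa> k *\<^sub>R w) \<bullet> z) *\<^sub>R e" for k z
  have linT: "linear (T k)" for k
    unfolding T_def by (intro linearI) (simp_all add: inner_add_right algebra_simps)
  \<comment> \<open>The slope must beat the sheared function on a ball that grows with \<open>k\<close>; a lower bound of \<open>1\<close>
    is enough on the far set, where \<open>f\<close> is bounded.\<close>
  have "\<exists>s\<ge>1. \<forall>z. norm z \<le> \<kappa> k * b / 4 \<longrightarrow> f (T k z) \<le> s * (\<kappa> k * b / 4)" for k
  proof -
    have contT: "continuous_on UNIV (\<lambda>z. f (T k z))"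
      by (intro continuous_on_compose2[OF cont] linear_continuous_on linear_conv_bounded_linear[THEN iffD1] linT) auto
    have "bounded ((\<lambda>z. f (T k z)) ` cball 0 (\<kappa> k * b / 4))"
      by (intro compact_imp_bounded compact_continuous_image continuous_on_subset[OF contT]) auto
    then obtain B where B: "B > 0" "\<And>z. norm z \<le> \<kappa> k * b / 4 \<Longrightarrow> \<bar>f (T k z)\<bar> \<le> B"
      unfolding bounded_pos by auto
    define s where "s = max 1 (B / (\<kappa> k * b / 4))"
    have "B \<le> s * (\<kappa> k * b / 4)"
      using \<kappa>[of k] b(1) by (subst pos_divide_le_eq[symmetric]) (simp_all add: s_def)
    with B(2) have "\<forall>z. norm z \<le> \<kappa> k * b / 4 \<longrightarrow> f (T k z) \<le> s * (\<kappa> k * b / 4)"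
      by (meson abs_le_D1 order_trans)
    moreover have "1 \<le> s" by (simp add: s_def)
    ultimately show ?thesis by blast
  qed
  then obtain s where s: "\<And>k. 1 \<le> s k"
    "\<And>k z. norm z \<le> \<kappa> k * b / 4 \<Longrightarrow> f (T k z) \<le> s k * (\<kappa> k * b / 4)"
    by metis
  define \<l> where "\<l> k z = ((- s k) *\<^sub>R e) \<bullet> z + (- s k * (\<kappa> k * b / 2))" for k z
  have \<l>: "\<l> k z = s k * (- (e \<bullet> z) - \<kappa> k * b / 2)" for k z
    by (simp add: \<l>_def algebra_simps)
  define G where "G k z = f (T k z) + \<l> k z" for k z
  define G' where "G' k z = f' (T k z) + \<l> k z" for k z
  have cvT: "convex_on UNIV (\<lambda>z. f (T k z))" "convex_on UNIV (\<lambda>z. f' (T k z))" for k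
    by (rule convex_on_compose_linear[OF f linT] convex_on_compose_linear[OF f' linT])+
  have cvG: "convex_on UNIV (G k)" "convex_on UNIV (G' k)" for k
    unfolding G_def G'_def \<l>_def by (intro convex_on_add cvT convex_on_affine)+
  have \<mu>T: "\<mu> (\<lambda>z. f (T k z)) = \<mu> f" "\<mu> (\<lambda>z. f' (T k z)) = \<mu> f'" for k
    unfolding T_def by (intro shear f f'; simp add: w)+
  have \<mu>G: "\<mu> (G k) = \<mu> f" "\<mu> (G' k) = \<mu> f'" for k
    unfolding G_def[abs_def] G'_def[abs_def] \<l>_def by (simp_all only: add_affine cvT \<mu>T)
  have GG': "G k z \<le> G' k z" for k z
    using le by (simp add: G_def G'_def)
  have ev: "\<forall>\<^sub>F k in sequentially. r \<le> \<kappa> k * b" for r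
  proof -
    have "\<forall>\<^sub>F k in sequentially. nat \<lceil>r / b\<rceil> \<le> k"
      by (rule eventually_ge_at_top)
    then show ?thesis
    proof eventually_elim
      case (elim k)
      then have "r / b \<le> \<kappa> k" unfolding \<kappa>_def by linarith
      then show ?case using b(1) by (simp add: divide_le_eq)
    qed
  qed
  have far: "\<kappa> k * b / 2 - C \<le> - (e \<bullet> z) - \<kappa> k * b / 2" if "f (T k z) \<noteq> f' (T k z)" for k z
  proof -
    have "w \<bullet> T k z = w \<bullet> z" "e \<bullet> T k z = e \<bullet> z + \<kappa> k * (w \<bullet> z)"
      using w unit by (simp_all add: T_def inner_add_right norm_eq_1)
    moreover have "e \<bullet> T k z \<le> C"
      using norm_cauchy_schwarz[of e "T k z"] C(2)[OF that] unit by simp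
    moreover have "\<kappa> k * b \<le> \<kappa> k * (w \<bullet> T k z)"
      using b(2)[OF that] \<kappa>[of k] by (intro mult_left_mono) auto
    ultimately show ?thesis by simp
  qed
  have nonpos: "G k z \<le> 0" if "norm z \<le> \<kappa> k * b / 4" for k z
  proof -
    have "- (e \<bullet> z) \<le> \<kappa> k * b / 4"
      using norm_cauchy_schwarz[of "- e" z] unit that by simp
    then have "s k * (- (e \<bullet> z) - \<kappa> k * b / 2) \<le> s k * (- (\<kappa> k * b / 4))"
      using s(1)[of k] by (intro mult_left_mono) auto
    then show ?thesis
      using s(2)[OF that] by (simp add: G_def \<l>)
  qed
  have nonneg: "0 \<le> G k z" if "2 * (C + M) \<le> \<kappa> k * b" "f (T k z) \<noteq> f' (T k z)" for k z
  proof -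
    have 1: "M \<le> - (e \<bullet> z) - \<kappa> k * b / 2"
    proof -
      have "M \<le> y - x / 2" if "x / 2 - C \<le> y - x / 2" "2 * (C + M) \<le> x" for x y
        using that by simp
      from this[OF far[OF that(2)] that(1)] show ?thesis .
    qed
    have "M \<le> s k * (- (e \<bullet> z) - \<kappa> k * b / 2)"
      using mult_mono[OF s(1)[of k] 1] s(1)[of k] M(2) 1 by simp
    then show ?thesis
      using M(1)[OF C(2)[OF that(2)]] by (simp add: G_def \<l>)
  qed
  have lim: "(\<lambda>k. max 0 (G k z)) \<longlonglongrightarrow> 0" "(\<lambda>k. max 0 (G' k z)) \<longlonglongrightarrow> 0" for z
  proof -
    have *: "\<forall>\<^sub>F k in sequentially. G k z \<le> 0 \<and> G' k z \<le> 0"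
      using ev[of "2 * C"] ev[of "4 * norm z"]
    proof eventually_elim
      case (elim k)
      have "f (T k z) = f' (T k z)"
      proof (rule ccontr)
        assume "f (T k z) \<noteq> f' (T k z)"
        from far[OF this] have "\<kappa> k * b - C \<le> norm z"
          using norm_cauchy_schwarz[of "- e" z] unit by simp
        then show False using elim C(1) by linarith
      qed
      then show ?case
        using nonpos[of z k] elim by (simp add: G_def G'_def)
    qed
    show "(\<lambda>k. max 0 (G k z)) \<longlonglongrightarrow> 0" "(\<lambda>k. max 0 (G' k z)) \<longlonglongrightarrow> 0"
      by (rule tendsto_eventually, rule eventually_mono[OF *], simp)+
  qed
  have cvmax: "convex_on UNIV (\<lambda>z. max 0 (G k z))" "convex_on UNIV (\<lambda>z. max 0 (G' k z))" for k
    by (intro convex_on_max cvG; simp add: convex_on_const)+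
  have "(\<lambda>k. \<mu> (\<lambda>z. max 0 (G' k z)) - \<mu> (\<lambda>z. max 0 (G k z))) \<longlonglongrightarrow> \<mu> (\<lambda>_. 0) - \<mu> (\<lambda>_. 0)"
    by (intro tendsto_diff continuous cvmax lim) (simp_all add: convex_on_const)
  moreover have "\<forall>\<^sub>F k in sequentially. \<mu> (\<lambda>z. max 0 (G' k z)) - \<mu> (\<lambda>z. max 0 (G k z)) = \<mu> f' - \<mu> f"
    using ev[of "2 * (C + M)"]
  proof eventually_elim
    case (elim k)
    have max: "(\<lambda>z. max (G' k z) (max 0 (G k z))) = (\<lambda>z. max 0 (G' k z))"
    proof
      show "max (G' k z) (max 0 (G k z)) = max 0 (G' k z)" for z
        using GG'[of k z] by linarith
    qed
    have min: "(\<lambda>z. min (G' k z) (max 0 (G k z))) = G k"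
    proof
      fix z
      show "min (G' k z) (max 0 (G k z)) = G k z"
      proof (cases "f (T k z) = f' (T k z)")
        case True
        then have "G' k z = G k z" by (simp add: G_def G'_def)
        then show ?thesis by simp
      next
        case False
        then show ?thesis using nonneg[OF elim] GG'[of k z] by simp
      qed
    qed
    show ?case
      using valuation[OF cvG(2)[of k] cvmax(1)[of k]] unfolding max min by (simp add: cvG \<mu>G)
  qed
  ultimately have "(\<lambda>k::nat. \<mu> f' - \<mu> f) \<longlonglongrightarrow> \<mu> (\<lambda>_. 0) - \<mu> (\<lambda>_. 0)"
    by (rule Lim_transform_eventually)
  then show ?thesis by (simp add: LIMSEQ_const_iff)
qed

text \<open>
  Truncating with the cones \<open>K * norm z - n\<close>, which are steeper than the affine function and recede as
  \<open>n\<close> grows, confines the set where the affine function is on top to a compact convex set. That set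
  misses the axis, so a hyperplane parallel to the axis separates the two.
\<close>

lemma max_affine_below_axis_strict:
  assumes f: "convex_on UNIV f" and below: "\<And>t. a \<bullet> (t *\<^sub>R e) + c < f (t *\<^sub>R e)"
  shows "\<mu> (\<lambda>z. max (f z) (a \<bullet> z + c)) = \<mu> f"
proof -
  define q where "q z = a \<bullet> z + c" for z
  define K where "K = norm a + 1"
  define g where "g n z = max (f z) (K * norm z - real n)" for n z
  have cvq: "convex_on UNIV q"
    unfolding q_def by (rule convex_on_affine)
  have "convex_on UNIV (\<lambda>z::'a. K * norm z + (- real n))" for n
    using convex_on_dist[OF convex_UNIV, of "0::'a"]
    by (intro convex_on_add convex_on_cmul) (simp_all add: K_def convex_on_const dist_norm)
  then have cvg: "convex_on UNIV (g n)" for n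
    unfolding g_def by (intro convex_on_max f) simp
  have contg: "continuous_on UNIV (g n)" for n
    using convex_on_continuous cvg by auto
  have eq: "\<mu> (\<lambda>z. max (g n z) (q z)) = \<mu> (g n)" for n
  proof -
    define Q where "Q = {z. g n z \<le> q z}"
    have "convex Q"
    proof (rule convexI)
      fix x y and u v :: real assume *: "x \<in> Q" "y \<in> Q" "0 \<le> u" "0 \<le> v" "u + v = 1"
      have "g n (u *\<^sub>R x + v *\<^sub>R y) \<le> u * g n x + v * g n y"
        using cvg * by (simp add: convex_on_def)
      also have "\<dots> \<le> u * q x + v * q y"
        using * by (intro add_mono mult_left_mono) (auto simp: Q_def)
      also have "\<dots> = q (u *\<^sub>R x + v *\<^sub>R y)"
        using \<open>u + v = 1\<close> by (simp add: q_def inner_add_right distrib_left) (metis distrib_right mult_1)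
      finally show "u *\<^sub>R x + v *\<^sub>R y \<in> Q" by (simp add: Q_def)
    qed
    moreover have bddQ: "bounded Q"
    proof (rule boundedI)
      fix z assume "z \<in> Q"
      then have "K * norm z - real n \<le> a \<bullet> z + c"
        by (simp add: Q_def g_def q_def)
      then show "norm z \<le> real n + c"
        using norm_cauchy_schwarz[of a z] by (simp add: K_def algebra_simps)
    qed
    moreover have "closed Q"
      unfolding Q_def q_def by (intro closed_Collect_le contg continuous_intros)
    ultimately have Q: "convex Q" "compact Q"
      by (simp_all add: compact_eq_bounded_closed)
    have differ: "z \<in> Q" if "g n z \<noteq> max (g n z) (q z)" for z
      using that by (simp add: Q_def max_def split: if_splits)
    show ?thesis
    proof (cases "Q = {}")
      case True
      then have "(\<lambda>z. max (g n z) (q z)) = g n"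
        using differ by fastforce
      then show ?thesis by simp
    next
      case False
      have "z \<notin> Q" if z: "z \<in> span {e}" for z
      proof -
        obtain t where "z = t *\<^sub>R e" using z unfolding span_singleton by blast
        then show ?thesis using below[of t] by (simp add: Q_def q_def g_def)
      qed
      then have "Q \<inter> span {e} = {}" by blast
      then obtain p \<beta> where p: "\<And>z. z \<in> Q \<Longrightarrow> p \<bullet> z < \<beta>" "\<And>z. z \<in> span {e} \<Longrightarrow> p \<bullet> z > \<beta>"
        using separating_hyperplane_compact_closed[OF Q False subspace_imp_convex[OF subspace_span] closed_span]
        by blast
      have \<beta>: "\<beta> < 0" using p(2)[OF span_zero] by simp
      \<comment> \<open>A linear form bounded below on a whole line vanishes along it.\<close>
      have "p \<bullet> e = 0"
      proof (rule ccontr)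
        assume "p \<bullet> e \<noteq> 0"
        then show False
          using p(2)[of "(\<beta> / (p \<bullet> e)) *\<^sub>R e"] by (simp add: span_base span_scale)
      qed
      moreover have "- \<beta> \<le> (- p) \<bullet> z" if "g n z \<noteq> max (g n z) (q z)" for z
        using p(1)[OF differ[OF that]] by simp
      moreover have "bounded {z. g n z \<noteq> max (g n z) (q z)}"
        using differ by (intro bounded_subset[OF bddQ]) auto
      ultimately show ?thesis
        using \<beta> by (intro eq_if_differ_off_axis[symmetric, where w = "- p" and b = "- \<beta>"] convex_on_max cvg cvq) auto
    qed
  qed
  have glim: "(\<lambda>n. g n z) \<longlonglongrightarrow> f z" for z
  proof (rule tendsto_eventually)
    have "\<forall>\<^sub>F n in sequentially. nat \<lceil>K * norm z - f z\<rceil> \<le> n"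
      by (rule eventually_ge_at_top)
    then show "\<forall>\<^sub>F n in sequentially. g n z = f z"
      by eventually_elim (unfold g_def, linarith)
  qed
  have "(\<lambda>n. \<mu> (\<lambda>z. max (g n z) (q z))) \<longlonglongrightarrow> \<mu> (\<lambda>z. max (f z) (q z))"
    by (intro continuous convex_on_max cvg cvq f tendsto_max glim tendsto_const)
  then have "(\<lambda>n. \<mu> (g n)) \<longlonglongrightarrow> \<mu> (\<lambda>z. max (f z) (q z))"
    unfolding eq .
  moreover have "(\<lambda>n. \<mu> (g n)) \<longlonglongrightarrow> \<mu> f"
    by (intro continuous cvg f glim)
  ultimately show ?thesis
    unfolding q_def by (rule LIMSEQ_unique)
qed

text \<open>
  Lowering the affine function by \<open>1/(n + 1)\<close> makes the inequality strict; continuity removes the shift.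
\<close>

lemma max_affine_below_axis:
  assumes f: "convex_on UNIV f" and below: "\<And>t. a \<bullet> (t *\<^sub>R e) + c \<le> f (t *\<^sub>R e)"
  shows "\<mu> (\<lambda>z. max (f z) (a \<bullet> z + c)) = \<mu> f"
proof -
  have "\<mu> (\<lambda>z. max (f z) (a \<bullet> z + (c - 1 / real (Suc n)))) = \<mu> f" for n
  proof (rule max_affine_below_axis_strict[OF f])
    have "0 < 1 / real (Suc n)" by simp
    then show "a \<bullet> (t *\<^sub>R e) + (c - 1 / real (Suc n)) < f (t *\<^sub>R e)" for t
      using below[of t] by linarith
  qed
  moreover have "(\<lambda>n. \<mu> (\<lambda>z. max (f z) (a \<bullet> z + (c - 1 / real (Suc n))))) \<longlonglongrightarrow> \<mu> (\<lambda>z. max (f z) (a \<bullet> z + (c - 0)))"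
    by (intro continuous convex_on_max convex_on_affine f tendsto_intros LIMSEQ_Suc lim_1_over_n)
  ultimately show ?thesis by (simp add: LIMSEQ_const_iff)
qed

lemma max_convex_below_axis:
  assumes f: "convex_on UNIV f" and h: "convex_on UNIV h" and below: "\<And>t. h (t *\<^sub>R e) \<le> f (t *\<^sub>R e)"
  shows "\<mu> (\<lambda>z. max (f z) (h z)) = \<mu> f"
proof -
  obtain a b where ab: "\<And>(i::nat) z. a i \<bullet> z + b i \<le> h z"
    "\<And>z e. e > 0 \<Longrightarrow> \<exists>i. h z - e < a i \<bullet> z + b i"
    using convex_countable_affine_minorants[OF h] by blast
  define g where "g = rec_nat f (\<lambda>i g z. max (g z) (a i \<bullet> z + b i))"
  have g0: "g 0 = f" and gSuc: "g (Suc n) = (\<lambda>z. max (g n z) (a n \<bullet> z + b n))" for n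
    by (simp_all add: g_def)
  have cvg: "convex_on UNIV (g n)" for n
    by (induction n) (simp_all add: g0 gSuc f convex_on_max convex_on_affine)
  have fg: "f z \<le> g n z" for n z
    by (induction n) (auto simp: g0 gSuc le_max_iff_disj)
  have gle: "g n z \<le> max (f z) (h z)" for n z
  proof (induction n)
    case (Suc n)
    then show ?case
      unfolding gSuc by (intro max.boundedI max.coboundedI2[OF ab(1)])
  qed (simp add: g0)
  have ple: "a i \<bullet> z + b i \<le> g n z" if "i < n" for i n z
    using that by (induction n) (auto simp: gSuc less_Suc_eq le_max_iff_disj)
  have "\<mu> (g n) = \<mu> f" for n
  proof (induction n)
    case (Suc n)
    have "a n \<bullet> (t *\<^sub>R e) + b n \<le> g n (t *\<^sub>R e)" for t
      using ab(1)[of n "t *\<^sub>R e"] below[of t] fg[of "t *\<^sub>R e" n] by linarith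
    from max_affine_below_axis[OF cvg this] show ?case
      by (simp add: gSuc Suc.IH)
  qed (simp add: g0)
  moreover have "(\<lambda>n. \<mu> (g n)) \<longlonglongrightarrow> \<mu> (\<lambda>z. max (f z) (h z))"
  proof (rule continuous)
    fix z
    show "(\<lambda>n. g n z) \<longlonglongrightarrow> max (f z) (h z)"
    proof (rule order_tendstoI)
      fix y assume y: "y < max (f z) (h z)"
      show "\<forall>\<^sub>F n in sequentially. y < g n z"
      proof (cases "y < f z")
        case True
        then show ?thesis using fg by (intro always_eventually allI) (rule less_le_trans)
      next
        case False
        then have "h z - y > 0" using y by simp
        then obtain i where "y < a i \<bullet> z + b i" using ab(2)[of "h z - y" z] by auto
        then have "y < g n z" if "i < n" for n
          using ple[OF that] by (rule less_le_trans)
        then show ?thesis using eventually_gt_at_top[of i] by (rule eventually_mono[rotated])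
      qed
    next
      fix y assume "max (f z) (h z) < y"
      then show "\<forall>\<^sub>F n in sequentially. g n z < y"
        using gle[of _ z] by (intro always_eventually allI) (rule le_less_trans)
    qed
  qed (intro cvg convex_on_max f h)+
  ultimately show ?thesis by (simp add: LIMSEQ_const_iff)
qed

text \<open>
  Neither function exceeds the other on the axis, so both have the same value as their maximum.
\<close>

theorem eq_if_eq_on_axis:
  assumes f: "convex_on UNIV f" and h: "convex_on UNIV h" and "\<And>t. f (t *\<^sub>R e) = h (t *\<^sub>R e)"
  shows "\<mu> f = \<mu> h"
  using max_convex_below_axis[OF f h] max_convex_below_axis[OF h f] assms(3) by (simp add: max.commute)

end

section \<open>Valuations on convex functions of one variable\<close>

text \<open>
  Cauchy's functional equation on the half line: linear on rational multiples of \<open>1\<close>, hence everywhere.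
\<close>

lemma additive_continuous_imp_linear:
  fixes Z :: "real \<Rightarrow> real"
  assumes add: "\<And>a b. 0 \<le> a \<Longrightarrow> 0 \<le> b \<Longrightarrow> Z (a + b) = Z a + Z b"
    and cont: "\<And>X a. (\<And>k. 0 \<le> X k) \<Longrightarrow> X \<longlonglongrightarrow> a \<Longrightarrow> (\<lambda>k. Z (X k)) \<longlonglongrightarrow> Z a"
    and a: "0 \<le> a"
  shows "Z a = a * Z 1"
proof -
  have mult: "Z (real n * b) = real n * Z b" if "0 \<le> b" for n b
  proof (induction n)
    case 0
    show ?case using add[of 0 0] by simp
  next
    case (Suc n)
    then show ?case using add[of "real n * b" b] that by (simp add: algebra_simps)
  qed
  define X where "X k = real (nat \<lfloor>a * real (Suc k)\<rfloor>) / real (Suc k)" for k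
  have Z: "Z (X k) = X k * Z 1" for k
  proof -
    have "Z (X k) = real (nat \<lfloor>a * real (Suc k)\<rfloor>) * Z (1 / real (Suc k))"
      using mult[of "1 / real (Suc k)" "nat \<lfloor>a * real (Suc k)\<rfloor>"] by (simp add: X_def)
    moreover have "Z 1 = real (Suc k) * Z (1 / real (Suc k))"
      using mult[of "1 / real (Suc k)" "Suc k"] by simp
    ultimately show ?thesis
      by (simp add: X_def del: of_nat_Suc)
  qed
  have "a - 1 / real (Suc k) \<le> X k" "X k \<le> a" for k
  proof -
    have "0 \<le> a * real (Suc k)" using a by simp
    then have *: "a * real (Suc k) - 1 \<le> real (nat \<lfloor>a * real (Suc k)\<rfloor>)"
      "real (nat \<lfloor>a * real (Suc k)\<rfloor>) \<le> a * real (Suc k)"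
      by linarith+
    have "a - 1 / real (Suc k) = (a * real (Suc k) - 1) / real (Suc k)"
      by (simp add: diff_divide_distrib del: of_nat_Suc)
    also have "\<dots> \<le> X k"
      unfolding X_def by (intro divide_right_mono *) simp
    finally show "a - 1 / real (Suc k) \<le> X k" .
    show "X k \<le> a"
      unfolding X_def using *(2) by (simp add: divide_le_eq del: of_nat_Suc)
  qed
  moreover have "(\<lambda>k. a - 1 / real (Suc k)) \<longlonglongrightarrow> a - 0"
    by (intro tendsto_intros LIMSEQ_Suc lim_1_over_n)
  ultimately have X: "X \<longlonglongrightarrow> a"
    by (intro tendsto_sandwich[of "\<lambda>k. a - 1 / real (Suc k)" X _ "\<lambda>_. a"]) auto
  then have "(\<lambda>k. Z (X k)) \<longlonglongrightarrow> Z a"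
    by (rule cont[rotated]) (simp add: X_def)
  moreover have "(\<lambda>k. Z (X k)) \<longlonglongrightarrow> a * Z 1"
    unfolding Z by (intro tendsto_intros X)
  ultimately show ?thesis
    by (rule LIMSEQ_unique)
qed

lemma convex_ge_affine_tail:
  fixes \<phi> :: "real \<Rightarrow> real"
  assumes "convex_on UNIV \<phi>" "\<And>s. t \<le> s \<Longrightarrow> \<phi> s = a * s + b"
  shows "a * s + b \<le> \<phi> s"
proof (cases "t \<le> s")
  case False
  have "\<phi> t \<le> (\<phi> s + \<phi> (2 * t - s)) / 2"
    using convex_onD[OF assms(1), of "1/2" s "2 * t - s"] by (simp add: field_simps)
  then show ?thesis
    using False assms(2)[of t] assms(2)[of "2 * t - s"] by (simp add: field_simps)
qed (use assms in simp)

abbreviation hinge :: "real \<Rightarrow> real \<Rightarrow> real \<Rightarrow> real" where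
  "hinge a t \<equiv> \<lambda>s. a * max 0 (s - t)"

lemma convex_on_affine_real: "convex_on UNIV (\<lambda>s::real. a * s + b)"
  using convex_on_affine[of a b] by simp

lemma convex_on_pos_part: "convex_on UNIV (\<lambda>s::real. max 0 (x * s + b))"
  by (intro convex_on_max convex_on_affine_real) (simp add: convex_on_const)

lemma convex_on_hinge: "0 \<le> a \<Longrightarrow> convex_on UNIV (hinge a t)"
  using convex_on_pos_part[of 1 "- t"] by (intro convex_on_cmul) simp_all

text \<open>
  Continuity is required along pointwise convergent sequences, which is how it is inherited from the
  epi-topology.
\<close>

locale line_valuation =
  fixes \<mu> :: "(real \<Rightarrow> real) \<Rightarrow> real"
  assumes valuation: "\<And>\<phi> \<psi>. convex_on UNIV \<phi> \<Longrightarrow> convex_on UNIV \<psi> \<Longrightarrow> convex_on UNIV (\<lambda>s. min (\<phi> s) (\<psi> s)) \<Longrightarrow>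
      \<mu> (\<lambda>s. max (\<phi> s) (\<psi> s)) + \<mu> (\<lambda>s. min (\<phi> s) (\<psi> s)) = \<mu> \<phi> + \<mu> \<psi>"
    and add_affine: "\<And>\<phi> a b. convex_on UNIV \<phi> \<Longrightarrow> \<mu> (\<lambda>s. \<phi> s + (a * s + b)) = \<mu> \<phi>"
    and continuous: "\<And>F \<phi>. (\<And>k. convex_on UNIV (F k)) \<Longrightarrow> convex_on UNIV \<phi> \<Longrightarrow>
      (\<And>s. (\<lambda>k. F k s) \<longlonglongrightarrow> \<phi> s) \<Longrightarrow> (\<lambda>k. \<mu> (F k)) \<longlonglongrightarrow> \<mu> \<phi>"
begin

lemma affine: "\<mu> (\<lambda>s. a * s + b) = \<mu> (\<lambda>_. 0)"
  using add_affine[of "\<lambda>_. 0" a b] by (simp add: convex_on_const)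

text \<open>
  If \<open>\<phi>\<close> coincides with an affine function \<open>l\<close> to the right of \<open>t\<close>, then \<open>\<phi> + hinge a t\<close> is the maximum of
  \<open>\<phi>\<close> and \<open>l + hinge a t\<close>, and their minimum is \<open>l\<close>. So a kink to the right of all others contributes
  additively.
\<close>

lemma add_hinge:
  assumes \<phi>: "convex_on UNIV \<phi>" and tail: "\<And>s. t \<le> s \<Longrightarrow> \<phi> s = p * s + q" and a: "0 \<le> a"
  shows "\<mu> (\<lambda>s. \<phi> s + hinge a t s) - \<mu> (\<lambda>_. 0) = (\<mu> \<phi> - \<mu> (\<lambda>_. 0)) + (\<mu> (hinge a t) - \<mu> (\<lambda>_. 0))"
proof -
  define \<psi> where "\<psi> = (\<lambda>s. hinge a t s + (p * s + q))"
  have cv: "convex_on UNIV \<psi>"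
    unfolding \<psi>_def by (intro convex_on_add convex_on_hinge a convex_on_affine_real)
  have le: "p * s + q \<le> \<phi> s" for s
    using convex_ge_affine_tail[OF \<phi> tail] .
  have "(\<lambda>s. max (\<phi> s) (\<psi> s)) = (\<lambda>s. \<phi> s + hinge a t s)"
  proof
    show "max (\<phi> s) (\<psi> s) = \<phi> s + hinge a t s" for s
      using le[of s] tail[of s] a by (cases "t \<le> s") (auto simp: \<psi>_def max_def)
  qed
  moreover have "(\<lambda>s. min (\<phi> s) (\<psi> s)) = (\<lambda>s. p * s + q)"
  proof
    show "min (\<phi> s) (\<psi> s) = p * s + q" for s
      using le[of s] tail[of s] a by (cases "t \<le> s") (auto simp: \<psi>_def min_def)
  qed
  moreover have "\<mu> \<psi> = \<mu> (hinge a t)"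
    unfolding \<psi>_def by (intro add_affine convex_on_hinge a)
  ultimately show ?thesis
    using valuation[OF \<phi> cv] affine[of p q] by (simp add: convex_on_affine_real)
qed

definition hinge_value :: "real \<Rightarrow> real" where
  "hinge_value t = \<mu> (hinge 1 t) - \<mu> (\<lambda>_. 0)"

text \<open>
  The case of two kinks at the same place gives additivity in the coefficient.
\<close>

lemma hinge_homogeneous:
  assumes "0 \<le> a"
  shows "\<mu> (hinge a t) - \<mu> (\<lambda>_. 0) = a * hinge_value t"
  unfolding hinge_value_def
proof (rule additive_continuous_imp_linear[where Z = "\<lambda>a. \<mu> (hinge a t) - \<mu> (\<lambda>_. 0)"])
  fix a b :: real assume ab: "0 \<le> a" "0 \<le> b"
  have "hinge a t s = a * s + (- a * t)" if "t \<le> s" for s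
    using that by (simp add: algebra_simps)
  from add_hinge[OF convex_on_hinge[OF ab(1)] this ab(2)]
  show "\<mu> (hinge (a + b) t) - \<mu> (\<lambda>_. 0) = \<mu> (hinge a t) - \<mu> (\<lambda>_. 0) + (\<mu> (hinge b t) - \<mu> (\<lambda>_. 0))"
    by (simp add: distrib_right)
next
  fix X a assume X: "\<And>k. 0 \<le> X k" "X \<longlonglongrightarrow> (a::real)"
  then have "0 \<le> a" by (intro LIMSEQ_le_const) auto
  then show "(\<lambda>k. \<mu> (hinge (X k) t) - \<mu> (\<lambda>_. 0)) \<longlonglongrightarrow> \<mu> (hinge a t) - \<mu> (\<lambda>_. 0)"
    using X by (intro tendsto_intros continuous convex_on_hinge)
qed (use assms in simp)

lemma reverse_hinge:
  assumes "0 \<le> a"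
  shows "\<mu> (\<lambda>s. a * max 0 (t - s)) = \<mu> (hinge a t)"
proof -
  have "(\<lambda>s. a * max 0 (t - s)) = (\<lambda>s. hinge a t s + (- a * s + a * t))"
    by (auto simp: max_def algebra_simps)
  then show ?thesis
    using add_affine[OF convex_on_hinge[OF assms], of t "- a" "a * t"] by simp
qed

text \<open>
  For \<open>x > 0\<close> the function is a multiple of the hinge at \<open>1 / x\<close>, for \<open>x < 0\<close> of the reversed hinge there,
  which differs from the hinge by an affine function. For \<open>x = 0\<close> both sides are \<open>0\<close>, whatever \<open>1 / 0\<close> is.
\<close>

lemma pos_part_value:
  "\<mu> (\<lambda>s. max 0 (x * s - 1)) - \<mu> (\<lambda>_. 0) = \<bar>x\<bar> * hinge_value (1 / x)"
proof -
  consider "x = 0" | "x > 0" | "x < 0" by linarith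
  then show ?thesis
  proof cases
    case 2
    have "(\<lambda>s. max 0 (x * s - 1)) = hinge x (1 / x)"
      using 2 by (auto simp: max_def field_simps)
    then show ?thesis using hinge_homogeneous[of x "1 / x"] 2 by simp
  next
    case 3
    have "(\<lambda>s. max 0 (x * s - 1)) = (\<lambda>s. (- x) * max 0 (1 / x - s))"
      using 3 by (auto simp: max_def field_simps)
    then show ?thesis
      using hinge_homogeneous[of "- x" "1 / x"] reverse_hinge[of "- x" "1 / x"] 3 by simp
  qed simp
qed

lemma hinge_value_tendsto:
  assumes "X \<longlonglongrightarrow> t"
  shows "(\<lambda>k. hinge_value (X k)) \<longlonglongrightarrow> hinge_value t"
  unfolding hinge_value_def
  by (intro tendsto_intros continuous convex_on_hinge assms) simp_all

text \<open>
  Hinges far away, scaled such that the valuation is \<open>1\<close> or \<open>- 1\<close> on them, converge pointwise to \<open>0\<close>, which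
  contradicts continuity.
\<close>

lemma hinge_value_compact_support:
  obtains S where "S > 0" "\<And>t. S < \<bar>t\<bar> \<Longrightarrow> hinge_value t = 0"
proof -
  have "\<exists>S>0. \<forall>t. S < \<bar>t\<bar> \<longrightarrow> hinge_value t = 0"
  proof (rule ccontr)
    assume "\<not> ?thesis"
    then have "\<exists>t. real (Suc k) < \<bar>t\<bar> \<and> hinge_value t \<noteq> 0" for k
      by (meson of_nat_0_less_iff zero_less_Suc)
    then obtain t where t: "\<And>k. real (Suc k) < \<bar>t k\<bar>" "\<And>k. hinge_value (t k) \<noteq> 0"
      by metis
    define a where "a k = 1 / \<bar>hinge_value (t k)\<bar>" for k
    have a: "0 \<le> a k" for k by (simp add: a_def)
    \<comment> \<open>The branch of the hinge is chosen such that the function vanishes on a neighbourhood of \<open>0\<close> that grows with \<open>k\<close>.\<close>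
    define F where "F k = (if 0 \<le> t k then hinge (a k) (t k) else (\<lambda>s. a k * max 0 (t k - s)))" for k
    have "convex_on UNIV (\<lambda>s. a k * max 0 (t k - s))" for k
      using convex_on_pos_part[of "- 1" "t k"] a by (intro convex_on_cmul) simp_all
    then have cv: "convex_on UNIV (F k)" for k
      using convex_on_hinge a by (simp add: F_def)
    have "(\<lambda>k. F k s) \<longlonglongrightarrow> 0" for s
    proof (rule tendsto_eventually)
      have "F k s = 0" if "nat \<lceil>\<bar>s\<bar>\<rceil> \<le> k" for k
        using t(1)[of k] that by (auto simp: F_def max_def)
      then show "\<forall>\<^sub>F k in sequentially. F k s = 0"
        using eventually_sequentially by blast
    qed
    then have "(\<lambda>k. \<mu> (F k) - \<mu> (\<lambda>_. 0)) \<longlonglongrightarrow> \<mu> (\<lambda>_. 0) - \<mu> (\<lambda>_. 0)"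
      by (intro tendsto_intros continuous cv) (simp_all add: convex_on_const)
    then have "(\<lambda>k. \<bar>\<mu> (F k) - \<mu> (\<lambda>_. 0)\<bar>) \<longlonglongrightarrow> \<bar>0\<bar>"
      by (intro tendsto_rabs) simp
    moreover have "\<bar>\<mu> (F k) - \<mu> (\<lambda>_. 0)\<bar> = 1" for k
    proof -
      have "\<mu> (F k) - \<mu> (\<lambda>_. 0) = a k * hinge_value (t k)"
        using hinge_homogeneous[OF a] reverse_hinge[OF a] by (simp add: F_def)
      then show ?thesis using t(2)[of k] by (simp add: a_def abs_mult)
    qed
    ultimately show False
      by (simp add: LIMSEQ_const_iff)
  qed
  then show thesis using that by blast
qed

end

text \<open>
  The piecewise linear function that interpolates \<open>\<phi>\<close> at the nodes \<open>u, u + d, \<dots>, u + (i + 1) d\<close> and continues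
  affinely beyond them. Written as a sum of hinges from left to right, it has the shape that
  \<open>add_hinge\<close> can process; the coefficients are second differences.
\<close>

primrec interpolant :: "(real \<Rightarrow> real) \<Rightarrow> real \<Rightarrow> real \<Rightarrow> nat \<Rightarrow> real \<Rightarrow> real" where
  "interpolant \<phi> u d 0 s = \<phi> u + (\<phi> (u + d) - \<phi> u) / d * (s - u)"
| "interpolant \<phi> u d (Suc i) s = interpolant \<phi> u d i s +
     (\<phi> (u + real (Suc (Suc i)) * d) - 2 * \<phi> (u + real (Suc i) * d) + \<phi> (u + real i * d)) / d *
     max 0 (s - (u + real (Suc i) * d))"

lemma interpolant_tail:
  assumes "d > 0" "u + real i * d \<le> s"
  shows "interpolant \<phi> u d i s =
    \<phi> (u + real i * d) + (\<phi> (u + real (Suc i) * d) - \<phi> (u + real i * d)) / d * (s - (u + real i * d))"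
  using assms(2)
proof (induction i)
  case (Suc i)
  have le: "u + real i * d \<le> s"
    using Suc.prems assms(1) by (simp add: algebra_simps)
  show ?case
    unfolding interpolant.simps Suc.IH[OF le] using Suc.prems assms(1)
    by (simp add: field_simps)
qed simp

text \<open>
  Hinges added later start at or to the right of \<open>s\<close>.
\<close>

lemma interpolant_eq:
  assumes "d > 0" "u + real i * d \<le> s" "s \<le> u + real (Suc i) * d" "i \<le> j"
  shows "interpolant \<phi> u d j s =
    \<phi> (u + real i * d) + (\<phi> (u + real (Suc i) * d) - \<phi> (u + real i * d)) / d * (s - (u + real i * d))"
proof -
  have "interpolant \<phi> u d j s = interpolant \<phi> u d i s"
    using assms(4)
  proof (induction j rule: dec_induct)
    case (step k)
    have "real (Suc i) * d \<le> real (Suc k) * d"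
      using step assms(1) by (intro mult_right_mono) auto
    then have "s - (u + real (Suc k) * d) \<le> 0"
      using assms(3) by linarith
    then show ?case
      using step by (simp only: interpolant.simps max_absorb1 mult_zero_right add_0_right)
  qed simp
  then show ?thesis
    using interpolant_tail[OF assms(1,2)] by simp
qed

lemma second_difference_nonneg:
  assumes "convex_on UNIV (\<phi> :: real \<Rightarrow> real)" "d > 0"
  shows "0 \<le> (\<phi> (u + real (Suc (Suc i)) * d) - 2 * \<phi> (u + real (Suc i) * d) + \<phi> (u + real i * d)) / d"
proof -
  have "(1 - 1/2) *\<^sub>R (u + real (Suc (Suc i)) * d) + (1/2) *\<^sub>R (u + real i * d) = u + real (Suc i) * d"
    by (simp add: field_simps)
  then have "\<phi> (u + real (Suc i) * d) \<le> 1/2 * \<phi> (u + real (Suc (Suc i)) * d) + 1/2 * \<phi> (u + real i * d)"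
    using convex_onD[OF assms(1), of "1/2" "u + real (Suc (Suc i)) * d" "u + real i * d"] by simp
  then show ?thesis
    using assms(2) by (intro divide_nonneg_pos) linarith+
qed

lemma convex_on_interpolant:
  assumes "convex_on UNIV \<phi>" "d > 0"
  shows "convex_on UNIV (interpolant \<phi> u d i)"
proof (induction i)
  case 0
  have "interpolant \<phi> u d 0 = (\<lambda>s. (\<phi> (u + d) - \<phi> u) / d * s + (\<phi> u - (\<phi> (u + d) - \<phi> u) / d * u))"
    by (auto simp: right_diff_distrib)
  then show ?case by (simp only: convex_on_affine_real)
next
  case (Suc i)
  have "interpolant \<phi> u d (Suc i) = (\<lambda>s. interpolant \<phi> u d i s +
      hinge ((\<phi> (u + real (Suc (Suc i)) * d) - 2 * \<phi> (u + real (Suc i) * d) + \<phi> (u + real i * d)) / d)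
        (u + real (Suc i) * d) s)"
    by auto
  then show ?case
    using convex_on_add[OF Suc convex_on_hinge[OF second_difference_nonneg[OF assms]]] by simp
qed

text \<open>
  At \<open>s\<close> the interpolant lies between the values of \<open>\<phi>\<close> at the two neighbouring nodes, and both nodes tend to
  \<open>s\<close>.
\<close>

lemma interpolant_tendsto:
  assumes \<phi>: "convex_on UNIV \<phi>"
  shows "(\<lambda>n. interpolant \<phi> (- real n) (1 / real (Suc n)) (2 * n * Suc n) s) \<longlonglongrightarrow> \<phi> s"
proof -
  define d where "d n = 1 / real (Suc n)" for n
  define i where "i n = nat \<lfloor>(s + real n) * real (Suc n)\<rfloor>" for n
  define p where "p n = - real n + real (i n) * d n" for n
  have d: "d n > 0" for n by (simp add: d_def)
  have dlim: "d \<longlonglongrightarrow> 0"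
    unfolding d_def by (intro LIMSEQ_Suc lim_1_over_n)
  have pd: "- real n + real (Suc (i n)) * d n = p n + d n" for n
    by (simp add: p_def algebra_simps)
  have near: "p n \<le> s \<and> s \<le> p n + d n \<and> i n \<le> 2 * n * Suc n" if n: "\<bar>s\<bar> \<le> real n" for n
  proof -
    have nn: "0 \<le> (s + real n) * real (Suc n)" using n by (intro mult_nonneg_nonneg) auto
    then have 1: "real (i n) \<le> (s + real n) * real (Suc n)" "(s + real n) * real (Suc n) \<le> real (i n) + 1"
      unfolding i_def by linarith+
    have "(s + real n) * real (Suc n) \<le> (2 * real n) * real (Suc n)"
      using n by (intro mult_right_mono) auto
    then have "real (i n) \<le> real (2 * n * Suc n)"
      using order_trans[OF 1(1)] by (simp only: of_nat_mult of_nat_numeral)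
    then have "i n \<le> 2 * n * Suc n" by (simp only: of_nat_le_iff)
    moreover have "real (i n) * d n \<le> s + real n" "s + real n \<le> (real (i n) + 1) * d n"
      using 1 by (simp_all add: d_def field_simps del: of_nat_Suc)
    ultimately show ?thesis
      unfolding p_def by (auto simp: algebra_simps simp del: of_nat_Suc of_nat_mult)
  qed
  have ev: "\<forall>\<^sub>F n in sequentially. \<bar>s\<bar> \<le> real n"
    using eventually_ge_at_top[of "nat \<lceil>\<bar>s\<bar>\<rceil>"] by eventually_elim linarith
  have plim: "p \<longlonglongrightarrow> s"
  proof (rule tendsto_sandwich)
    show "\<forall>\<^sub>F n in sequentially. s - d n \<le> p n" "\<forall>\<^sub>F n in sequentially. p n \<le> s"
      using ev by (eventually_elim, use near in force)+
    show "(\<lambda>n. s - d n) \<longlonglongrightarrow> s" using tendsto_diff[OF tendsto_const dlim, of s] by simp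
  qed simp
  have pdlim: "(\<lambda>n. p n + d n) \<longlonglongrightarrow> s"
    using tendsto_add[OF plim dlim] by simp
  have cont: "isCont \<phi> s"
    by (rule convex_on_imp_isCont[OF \<phi>])
  have lims: "(\<lambda>n. \<phi> (p n)) \<longlonglongrightarrow> \<phi> s" "(\<lambda>n. \<phi> (p n + d n)) \<longlonglongrightarrow> \<phi> s"
    using isCont_tendsto_compose[OF cont plim] isCont_tendsto_compose[OF cont pdlim] by auto
  have between: "min x y \<le> x + (y - x) * c \<and> x + (y - x) * c \<le> max x y" if "0 \<le> c" "c \<le> 1" for x y c :: real
  proof -
    have "min x y * (1 - c) + min x y * c \<le> x * (1 - c) + y * c" "x * (1 - c) + y * c \<le> max x y * (1 - c) + max x y * c"
      using that by (auto intro!: add_mono mult_right_mono)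
    then show ?thesis by (simp add: algebra_simps)
  qed
  have "\<forall>\<^sub>F n in sequentially. min (\<phi> (p n)) (\<phi> (p n + d n)) \<le> interpolant \<phi> (- real n) (d n) (2 * n * Suc n) s \<and>
      interpolant \<phi> (- real n) (d n) (2 * n * Suc n) s \<le> max (\<phi> (p n)) (\<phi> (p n + d n))"
    using ev
  proof eventually_elim
    case (elim n)
    have "interpolant \<phi> (- real n) (d n) (2 * n * Suc n) s = \<phi> (p n) + (\<phi> (p n + d n) - \<phi> (p n)) * ((s - p n) / d n)"
      using interpolant_eq[OF d, of "- real n" "i n" n s "2 * n * Suc n" \<phi>] near[OF elim]
      unfolding pd p_def[symmetric] by simp
    moreover have "0 \<le> (s - p n) / d n" "(s - p n) / d n \<le> 1"
      using near[OF elim] d[of n] by (auto simp: field_simps)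
    ultimately show ?case using between by (simp only:)
  qed
  then have "\<forall>\<^sub>F n in sequentially. min (\<phi> (p n)) (\<phi> (p n + d n)) \<le> interpolant \<phi> (- real n) (d n) (2 * n * Suc n) s"
    "\<forall>\<^sub>F n in sequentially. interpolant \<phi> (- real n) (d n) (2 * n * Suc n) s \<le> max (\<phi> (p n)) (\<phi> (p n + d n))"
    by (auto elim: eventually_mono)
  moreover have "(\<lambda>n. min (\<phi> (p n)) (\<phi> (p n + d n))) \<longlonglongrightarrow> \<phi> s" "(\<lambda>n. max (\<phi> (p n)) (\<phi> (p n + d n))) \<longlonglongrightarrow> \<phi> s"
    using tendsto_min[OF lims] tendsto_max[OF lims] by simp_all
  ultimately show ?thesis
    unfolding d_def by (rule tendsto_sandwich)
qed

context line_valuation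
begin

text \<open>
  The valuation vanishes on all interpolants by induction on the number of kinks, and these are dense.
\<close>

lemma eq_zero_if_hinges_vanish:
  assumes zero: "\<mu> (\<lambda>_. 0) = 0" and vanish: "\<And>t. hinge_value t = 0" and \<phi>: "convex_on UNIV \<phi>"
  shows "\<mu> \<phi> = 0"
proof -
  have hinge: "\<mu> (hinge a t) = 0" if "0 \<le> a" for a t
    using hinge_homogeneous[OF that, of t] zero vanish by simp
  have interp: "\<mu> (interpolant \<phi> u d i) = 0" if d: "d > 0" for u d i
  proof (induction i)
    case 0
    have "interpolant \<phi> u d 0 = (\<lambda>s. (\<phi> (u + d) - \<phi> u) / d * s + (\<phi> u - (\<phi> (u + d) - \<phi> u) / d * u))"
      by (auto simp: right_diff_distrib)
    then show ?case by (simp only: affine zero)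
  next
    case (Suc i)
    define m where "m = (\<phi> (u + real (Suc i) * d) - \<phi> (u + real i * d)) / d"
    define a where "a = (\<phi> (u + real (Suc (Suc i)) * d) - 2 * \<phi> (u + real (Suc i) * d) + \<phi> (u + real i * d)) / d"
    have "interpolant \<phi> u d i s = m * s + (\<phi> (u + real i * d) - m * (u + real i * d))"
      if "u + real (Suc i) * d \<le> s" for s
    proof -
      have "u + real i * d \<le> s" using that d by (simp add: algebra_simps)
      from interpolant_tail[OF d this, of \<phi>] show ?thesis
        unfolding m_def[symmetric] by (simp only: right_diff_distrib)
    qed
    moreover have "0 \<le> a"
      unfolding a_def by (rule second_difference_nonneg[OF \<phi> d])
    ultimately have "\<mu> (\<lambda>s. interpolant \<phi> u d i s + hinge a (u + real (Suc i) * d) s) = 0"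
      using add_hinge[OF convex_on_interpolant[OF \<phi> d], of "u + real (Suc i) * d" u i m _ a]
        Suc.IH hinge[of a] zero by simp
    moreover have "interpolant \<phi> u d (Suc i) = (\<lambda>s. interpolant \<phi> u d i s + hinge a (u + real (Suc i) * d) s)"
      by (auto simp: a_def)
    ultimately show ?case by simp
  qed
  have "(\<lambda>n. \<mu> (interpolant \<phi> (- real n) (1 / real (Suc n)) (2 * n * Suc n))) \<longlonglongrightarrow> \<mu> \<phi>"
    by (intro continuous convex_on_interpolant interpolant_tendsto \<phi>) simp
  then show ?thesis
    using interp by (simp add: LIMSEQ_const_iff)
qed

end

section \<open>The second derivative of a convex function as a measure\<close>

text \<open>
  Subdividing \<open>[a, b]\<close> into \<open>n\<close> equal parts and adding up bounds the increment by
  \<open>(b - a) (D b - D a) / n\<close>. In this way two functions can be identified through a common monotone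
  slope without differentiating either of them.
\<close>

lemma constant_if_increments_dominated:
  fixes E D :: "real \<Rightarrow> real"
  assumes dom: "\<And>a b. a < b \<Longrightarrow> \<bar>E b - E a\<bar> \<le> (b - a) * (D b - D a)" and ab: "a < b"
  shows "E a = E b"
proof -
  have bound: "\<bar>E b - E a\<bar> \<le> (b - a) * (D b - D a) / real (Suc n)" for n
  proof -
    define h where "h = (b - a) / real (Suc n)"
    define t where "t i = a + real i * h" for i
    have h: "h > 0" using ab by (simp add: h_def)
    have t: "t 0 = a" "t (Suc n) = b"
      by (simp_all add: t_def h_def del: of_nat_Suc)
    have step: "t i < t (Suc i)" "t (Suc i) - t i = h" for i
      using h by (simp_all add: t_def algebra_simps)
    have "\<bar>E b - E a\<bar> = \<bar>\<Sum>i<Suc n. E (t (Suc i)) - E (t i)\<bar>"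
      using sum_lessThan_telescope[of "\<lambda>i. E (t i)" "Suc n"] t by simp
    also have "\<dots> \<le> (\<Sum>i<Suc n. \<bar>E (t (Suc i)) - E (t i)\<bar>)"
      by (rule sum_abs)
    also have "\<dots> \<le> (\<Sum>i<Suc n. h * (D (t (Suc i)) - D (t i)))"
      using dom step by (intro sum_mono) metis
    also have "\<dots> = h * (D b - D a)"
      using sum_lessThan_telescope[of "\<lambda>i. D (t i)" "Suc n"] t by (simp add: sum_distrib_left[symmetric])
    finally show ?thesis by (simp add: h_def)
  qed
  have "(\<lambda>n. (b - a) * (D b - D a) * (1 / real (Suc n))) \<longlonglongrightarrow> (b - a) * (D b - D a) * 0"
    by (intro tendsto_intros LIMSEQ_Suc lim_1_over_n)
  then have "\<bar>E b - E a\<bar> \<le> 0"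
    by (intro LIMSEQ_le_const[of "\<lambda>n. (b - a) * (D b - D a) * (1 / real (Suc n))"]) (use bound in auto)
  then show ?thesis by simp
qed

text \<open>
  For a convex function this is the right derivative.
\<close>

definition right_slope :: "(real \<Rightarrow> real) \<Rightarrow> real \<Rightarrow> real" where
  "right_slope h x = (INF y\<in>{x<..}. (h y - h x) / (y - x))"

context
  fixes h :: "real \<Rightarrow> real"
  assumes cv: "convex_on UNIV h"
begin

lemma slope_mono:
  assumes "a < b" "b < c"
  shows "(h b - h a) / (b - a) \<le> (h c - h a) / (c - a)" "(h c - h a) / (c - a) \<le> (h c - h b) / (c - b)"
proof -
  have flip: "(h p - h q) / (p - q) = (h q - h p) / (q - p)" for p q
    by (metis minus_diff_eq minus_divide_divide)
  show "(h b - h a) / (b - a) \<le> (h c - h a) / (c - a)" "(h c - h a) / (c - a) \<le> (h c - h b) / (c - b)"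
    using convex_on_slope_le[OF cv, of a c b] assms flip[of a b] flip[of a c] flip[of b c] by auto
qed

lemma slope_mono':
  "a < b \<Longrightarrow> b < c \<Longrightarrow> (h b - h a) / (b - a) \<le> (h c - h b) / (c - b)"
  using slope_mono[of a b c] by linarith

lemma bdd_below_slopes: "bdd_below ((\<lambda>y. (h y - h x) / (y - x)) ` {x<..})"
  using slope_mono'[of "x - 1" x] by (intro bdd_belowI2[of _ "(h x - h (x - 1)) / (x - (x - 1))"]) auto

lemma right_slope_le: "x < y \<Longrightarrow> right_slope h x \<le> (h y - h x) / (y - x)"
  unfolding right_slope_def by (intro cINF_lower bdd_below_slopes) simp

lemma right_slope_ge: "x < y \<Longrightarrow> (h y - h x) / (y - x) \<le> right_slope h y"
  unfolding right_slope_def using slope_mono' by (intro cINF_greatest) auto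

lemma right_slope_mono: "x \<le> y \<Longrightarrow> right_slope h x \<le> right_slope h y"
  using right_slope_le[of x y] right_slope_ge[of x y] by (cases "x = y") auto

lemma right_slope_increment:
  assumes "a < b"
  shows "(b - a) * right_slope h a \<le> h b - h a" "h b - h a \<le> (b - a) * right_slope h b"
  using right_slope_le[OF assms] right_slope_ge[OF assms] assms by (simp_all add: field_simps)

lemma right_slope_right_continuous: "continuous (at_right a) (right_slope h)"
  unfolding continuous_within
proof (rule order_tendstoI)
  fix c assume c: "c < right_slope h a"
  have "\<forall>\<^sub>F x in at_right a. a < x"
    by (simp add: eventually_at_filter)
  then show "\<forall>\<^sub>F x in at_right a. c < right_slope h x"
    by (rule eventually_mono) (rule less_le_trans[OF c right_slope_mono], simp)
next
  fix c assume "right_slope h a < c"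
  then obtain y where y: "a < y" "(h y - h a) / (y - a) < c"
    unfolding right_slope_def using cINF_less_iff[OF _ bdd_below_slopes[of a], of c] by auto
  have "((\<lambda>x. (h y - h x) / (y - x)) \<longlongrightarrow> (h y - h a) / (y - a)) (at_right a)"
    using convex_on_imp_isCont[OF cv, of a] y(1)
    by (intro tendsto_intros) (auto simp: isCont_def intro: tendsto_within_subset)
  then have "\<forall>\<^sub>F x in at_right a. (h y - h x) / (y - x) < c"
    using y(2) by (rule order_tendstoD)
  moreover have "\<forall>\<^sub>F x in at_right a. x < y"
    using y(1) eventually_at_right by blast
  ultimately show "\<forall>\<^sub>F x in at_right a. right_slope h x < c"
    by eventually_elim (use right_slope_le in fastforce)
qed

text \<open>
  The difference quotients from a fixed point have the same limits at infinity as \<open>h x / x\<close>.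
\<close>

lemma right_slope_bounds:
  assumes top: "((\<lambda>x. h x / x) \<longlongrightarrow> p) at_top" and bot: "((\<lambda>x. h x / x) \<longlongrightarrow> q) at_bot"
  shows "q \<le> right_slope h x" "right_slope h x \<le> p"
proof -
  have lim: "((\<lambda>y. (h y - h x) / (y - x)) \<longlongrightarrow> p) at_top" "((\<lambda>y. (h y - h x) / (y - x)) \<longlongrightarrow> q) at_bot"
  proof -
    have eq: "(h y / y - h x * (1 / y)) / (1 - x * (1 / y)) = (h y - h x) / (y - x)" if "y \<noteq> 0" for y
    proof -
      have "h y / y - h x * (1 / y) = (h y - h x) / y" "1 - x * (1 / y) = (y - x) / y"
        using that by (simp_all add: field_simps)
      then show ?thesis using that by simp
    qed
    have "((\<lambda>y::real. 1 / y) \<longlongrightarrow> 0) at_top" "((\<lambda>y::real. 1 / y) \<longlongrightarrow> 0) at_bot"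
      by (intro tendsto_divide_0[OF tendsto_const] filterlim_at_top_imp_at_infinity
          filterlim_at_bot_imp_at_infinity filterlim_ident)+
    then have "((\<lambda>y. (h y / y - h x * (1 / y)) / (1 - x * (1 / y))) \<longlongrightarrow> (p - h x * 0) / (1 - x * 0)) at_top"
      "((\<lambda>y. (h y / y - h x * (1 / y)) / (1 - x * (1 / y))) \<longlongrightarrow> (q - h x * 0) / (1 - x * 0)) at_bot"
      by (intro tendsto_intros top bot; simp)+
    moreover have "\<forall>\<^sub>F y in at_top. (h y / y - h x * (1 / y)) / (1 - x * (1 / y)) = (h y - h x) / (y - x)"
      using eventually_gt_at_top[of 0] by eventually_elim (use eq in auto)
    moreover have "\<forall>\<^sub>F y in at_bot. (h y / y - h x * (1 / y)) / (1 - x * (1 / y)) = (h y - h x) / (y - x)"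
      using eventually_gt_at_bot[of 0] by eventually_elim (use eq in auto)
    ultimately show "((\<lambda>y. (h y - h x) / (y - x)) \<longlongrightarrow> p) at_top" "((\<lambda>y. (h y - h x) / (y - x)) \<longlongrightarrow> q) at_bot"
      by (auto dest: tendsto_cong[THEN iffD1, rotated])
  qed
  show "right_slope h x \<le> p"
  proof (rule tendsto_lowerbound[OF lim(1)])
    show "\<forall>\<^sub>F y in at_top. right_slope h x \<le> (h y - h x) / (y - x)"
      using eventually_gt_at_top[of x] by eventually_elim (rule right_slope_le)
  qed simp
  show "q \<le> right_slope h x"
  proof (rule tendsto_upperbound[OF lim(2)])
    have "(h y - h x) / (y - x) = (h x - h y) / (x - y)" for y
      by (metis minus_diff_eq minus_divide_divide)
    then have "(h y - h x) / (y - x) \<le> right_slope h x" if "y < x" for y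
      using right_slope_ge[OF that] by simp
    then show "\<forall>\<^sub>F y in at_bot. (h y - h x) / (y - x) \<le> right_slope h x"
      using eventually_gt_at_bot[of x] by (rule eventually_mono[rotated])
  qed simp
qed

lemma right_slope_limits:
  assumes top: "((\<lambda>x. h x / x) \<longlongrightarrow> p) at_top" and bot: "((\<lambda>x. h x / x) \<longlongrightarrow> q) at_bot" and "h 0 = 0"
  shows "(right_slope h \<longlongrightarrow> p) at_top" "(right_slope h \<longlongrightarrow> q) at_bot"
proof -
  have "\<forall>\<^sub>F x in at_top. h x / x \<le> right_slope h x"
    using eventually_gt_at_top[of 0] by eventually_elim (use right_slope_ge[of 0] assms(3) in auto)
  moreover have "\<forall>\<^sub>F x in at_top. right_slope h x \<le> p"
    using right_slope_bounds[OF top bot] by simp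
  ultimately show "(right_slope h \<longlongrightarrow> p) at_top"
    using top tendsto_const by (rule tendsto_sandwich)
  have "\<forall>\<^sub>F x in at_bot. right_slope h x \<le> h x / x"
    using eventually_gt_at_bot[of 0] by eventually_elim (use right_slope_le[of _ 0] assms(3) in auto)
  moreover have "\<forall>\<^sub>F x in at_bot. q \<le> right_slope h x"
    using right_slope_bounds[OF top bot] by simp
  ultimately show "(right_slope h \<longlongrightarrow> q) at_bot"
    by (intro tendsto_sandwich[of "\<lambda>_. q" "right_slope h" _ "\<lambda>x. h x / x"] bot) auto
qed

end

text \<open>
  As a function of \<open>x\<close>, the hinge at \<open>r\<close> that vanishes on the side of \<open>0\<close>. A convex
  function vanishing near \<open>0\<close> is the superposition of ramps according to its second derivative.
\<close>

definition ramp :: "real \<Rightarrow> real \<Rightarrow> real" where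
  "ramp x r = (if 0 < r then max 0 (x - r) else max 0 (r - x))"

lemma ramp_measurable [measurable]: "ramp x \<in> borel_measurable borel"
  unfolding ramp_def by measurable

lemma abs_ramp_le: "\<bar>ramp x r\<bar> \<le> \<bar>x\<bar>"
  by (auto simp: ramp_def)

lemma ramp_increment:
  assumes "a < b"
  shows "(b - a) * (indicator {..a} r - indicator {..0} r) \<le> ramp b r - ramp a r"
    "ramp b r - ramp a r \<le> (b - a) * (indicator {..b} r - indicator {..0} r)"
  using assms by (auto simp: ramp_def indicator_def max_def)

text \<open>
  The measure has distribution function \<open>right_slope h + g\<close>. Both \<open>h\<close> and the superposition of ramps have
  increments over \<open>[a, b]\<close> between \<open>(b - a) * right_slope h a\<close> and \<open>(b - a) * right_slope h b\<close>, so they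
  differ by a constant. Each half line carries mass \<open>g\<close> because the slope climbs from \<open>- g\<close> to \<open>0\<close> to
  \<open>g\<close>.
\<close>

lemma convex_eq_integral_ramp:
  fixes h :: "real \<Rightarrow> real"
  assumes cv: "convex_on UNIV h" and zero: "\<delta> > 0" "\<And>x. \<bar>x\<bar> < \<delta> \<Longrightarrow> h x = 0"
    and top: "((\<lambda>x. h x / x) \<longlongrightarrow> g) at_top" and bot: "((\<lambda>x. h x / x) \<longlongrightarrow> - g) at_bot"
  obtains m :: "real measure" where "sets m = sets borel" "finite_measure m"
    "AE r in m. \<delta> / 2 \<le> \<bar>r\<bar>" "measure m {0<..} = measure m {..<0}" "\<And>x. h x = (\<integral>r. ramp x r \<partial>m)"
proof -
  define F where "F x = right_slope h x + g" for x
  define m where "m = interval_measure F"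
  note D = right_slope_mono[OF cv] right_slope_right_continuous[OF cv] right_slope_increment[OF cv]
  have h0: "h 0 = 0" using zero by simp
  have D0: "right_slope h x = 0" if "\<bar>x\<bar> < \<delta>" for x
  proof (rule antisym)
    define y where "y = (x + \<delta>) / 2"
    define z where "z = (x - \<delta>) / 2"
    have "x < y" "\<bar>y\<bar> < \<delta>" "z < x" "\<bar>z\<bar> < \<delta>"
      using that unfolding y_def z_def by (auto simp: abs_less_iff field_simps)
    then show "right_slope h x \<le> 0" "0 \<le> right_slope h x"
      using right_slope_le[OF cv, of x y] right_slope_ge[OF cv, of z x] zero(2) that by auto
  qed
  have F_mono: "F x \<le> F y" if "x \<le> y" for x y
    using D(1)[OF that] by (simp add: F_def)
  have F_cont: "continuous (at_right a) F" for a
    unfolding F_def by (intro continuous_intros D)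
  have F_bot: "(F \<longlongrightarrow> 0) at_bot"
    using tendsto_add[OF right_slope_limits(2)[OF cv top bot h0] tendsto_const[of g]] by (simp add: F_def[abs_def])
  have F_top: "(F \<longlongrightarrow> 2 * g) at_top"
    using tendsto_add[OF right_slope_limits(1)[OF cv top bot h0] tendsto_const[of g]] by (simp add: F_def[abs_def])
  have g: "0 \<le> g"
    using right_slope_bounds[OF cv top bot, of 0] by simp
  have g2: "0 \<le> 2 * g" using g by simp
  interpret finite_borel_measure m
    unfolding m_def by (rule finite_borel_measure_interval_measure[OF F_mono F_cont F_bot F_top g2])
  have sets: "sets m = sets borel" by (simp add: m_def)
  have total: "measure m UNIV = 2 * g"
    using interval_measure_UNIV[OF F_mono F_cont F_bot F_top g2] g by (simp add: m_def measure_def)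
  have Ioc: "measure m {a<..b} = F b - F a" if "a \<le> b" for a b
    unfolding m_def using measure_interval_measure_Ioc[OF that F_mono F_cont] .
  have Iic: "measure m {..b} = F b" for b
  proof -
    have "cdf m b - (F b - F x) = cdf m x" if "x < b" for x
      using cdf_diff_eq[OF that] Ioc[of x b] that by simp
    then have "\<forall>\<^sub>F x in at_bot. cdf m b - (F b - F x) = cdf m x"
      using eventually_gt_at_bot[of b] by (rule eventually_mono[rotated])
    moreover have "((\<lambda>x. cdf m b - (F b - F x)) \<longlongrightarrow> cdf m b - (F b - 0)) at_bot"
      by (intro tendsto_intros F_bot)
    ultimately have "(cdf m \<longlongrightarrow> cdf m b - (F b - 0)) at_bot"
      by (auto dest: tendsto_cong[THEN iffD1, rotated])
    then have "cdf m b - (F b - 0) = 0"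
      using cdf_lim_at_bot tendsto_unique[of "at_bot :: real filter"] by fastforce
    then show ?thesis by (simp add: cdf_def)
  qed
  \<comment> \<open>The endpoints must lie inside the interval where the slope vanishes, hence \<open>\<delta> / 2\<close>.\<close>
  have "AE r in m. r \<notin> {- \<delta> / 2<..\<delta> / 2}"
    using Ioc[of "- \<delta> / 2" "\<delta> / 2"] D0[of "\<delta> / 2"] D0[of "- \<delta> / 2"] zero(1)
    by (intro AE_not_in) (simp add: null_sets_def emeasure_eq_measure sets F_def)
  then have AE: "AE r in m. \<delta> / 2 \<le> \<bar>r\<bar>"
    by eventually_elim auto
  have "measure m {0} = 0"
  proof -
    have "AE r in m. r \<notin> {0}"
      using AE by eventually_elim (use zero(1) in auto)
    then show ?thesis
      using AE_iff_measurable[of "{0}" m "\<lambda>r. r \<notin> {0}"] by (simp add: sets measure_def m_def)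
  qed
  moreover have "measure m {..0} = measure m {..<0} + measure m {0}"
    by (subst finite_measure_Union[symmetric]) (auto simp: sets intro!: arg_cong[of _ _ "measure m"])
  moreover have "measure m UNIV = measure m {..0} + measure m {0<..}"
    by (subst finite_measure_Union[symmetric]) (auto simp: sets intro!: arg_cong[of _ _ "measure m"])
  moreover have "F 0 = g" using D0[of 0] zero(1) by (simp add: F_def)
  ultimately have balanced: "measure m {0<..} = measure m {..<0}"
    using total Iic[of 0] by simp
  have int: "integrable m (ramp x)" for x
    by (rule integrable_const_bound[of _ "\<bar>x\<bar>"]) (use abs_ramp_le sets in \<open>auto cong: measurable_cong_sets\<close>)
  have int_ind: "integrable m (\<lambda>r. (b - a) * (indicator {..c} r - indicator {..0} r))" for a b c :: real
    by (intro integrable_mult_right Bochner_Integration.integrable_diff integrable_real_indicator)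
      (auto simp: sets emeasure_eq_measure)
  have val_ind: "(\<integral>r. (b - a) * (indicator {..c} r - indicator {..0} r) \<partial>m) = (b - a) * right_slope h c" for a b c
  proof -
    have "(\<integral>r. indicator {..c} r - indicator {..0} r \<partial>m) = measure m {..c} - measure m {..0}"
      by (subst Bochner_Integration.integral_diff) (auto simp: sets emeasure_eq_measure)
    also have "\<dots> = right_slope h c"
      using Iic D0[of 0] zero(1) by (simp add: F_def)
    finally show ?thesis by simp
  qed
  define E where "E x = h x - (\<integral>r. ramp x r \<partial>m)" for x
  have dom: "\<bar>E b - E a\<bar> \<le> (b - a) * (right_slope h b - right_slope h a)" if "a < b" for a b
  proof -
    have "(\<integral>r. (b - a) * (indicator {..a} r - indicator {..0} r) \<partial>m) \<le> (\<integral>r. ramp b r - ramp a r \<partial>m)"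
      by (intro integral_mono int_ind Bochner_Integration.integrable_diff int ramp_increment that)
    moreover have "(\<integral>r. ramp b r - ramp a r \<partial>m) \<le> (\<integral>r. (b - a) * (indicator {..b} r - indicator {..0} r) \<partial>m)"
      by (intro integral_mono int_ind Bochner_Integration.integrable_diff int ramp_increment that)
    ultimately show ?thesis
      using D(3,4)[OF that] unfolding val_ind E_def
      by (simp add: Bochner_Integration.integral_diff[OF int int] algebra_simps)
  qed
  have "E x = E 0" for x
    using constant_if_increments_dominated[of E "right_slope h", OF dom] by (metis linorder_neqE_linordered_idom)
  moreover have "E 0 = 0"
    using h0 by (simp add: E_def ramp_def max_def) (auto intro!: integral_eq_zero_AE simp: not_less)
  ultimately have "h x = (\<integral>r. ramp x r \<partial>m)" for x
    by (simp add: E_def)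
  with that[of m] sets finite_measure_axioms AE balanced show thesis by blast
qed

section \<open>Radial integrals and the one-dimensional representation\<close>

definition radial_integral :: "real measure \<Rightarrow> (real \<Rightarrow> real) \<Rightarrow> real" where
  "radial_integral \<nu> \<phi> = (LINT s : - {0} | \<nu>. (\<phi> s - \<phi> 0) / \<bar>s\<bar> ^ 2)"

text \<open>
  The chords from \<open>0\<close> to \<open>S\<close> and to \<open>- S\<close> bound \<open>\<phi>\<close> from above; reflection in \<open>0\<close> turns this into a
  lower bound.
\<close>

lemma convex_increment_bound:
  fixes \<phi> :: "real \<Rightarrow> real"
  assumes \<phi>: "convex_on UNIV \<phi>" and s: "\<bar>s\<bar> \<le> S" "S > 0"
  shows "\<bar>\<phi> s - \<phi> 0\<bar> \<le> \<bar>s\<bar> * ((\<bar>\<phi> S - \<phi> 0\<bar> + \<bar>\<phi> (- S) - \<phi> 0\<bar>) / S)"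
proof -
  define t where "t = \<bar>s\<bar> / S"
  have t: "0 \<le> t" "t \<le> 1" using s by (auto simp: t_def)
  have ts: "(1 - t) *\<^sub>R 0 + t *\<^sub>R (sgn s * S) = s"
    using s(2) by (simp add: t_def sgn_if abs_if)
  have chord: "\<phi> (p * t) - \<phi> 0 \<le> t * (\<phi> p - \<phi> 0)" for p
    using convex_onD[OF \<phi> t, of 0 p] by (simp add: algebra_simps)
  have reflect: "2 * \<phi> 0 \<le> \<phi> s + \<phi> (- s)"
    using convex_onD[OF \<phi>, of "1/2" s "- s"] by simp
  define B where "B = \<bar>\<phi> S - \<phi> 0\<bar> + \<bar>\<phi> (- S) - \<phi> 0\<bar>"
  have ends: "t * (\<phi> p - \<phi> 0) \<le> t * B" if "p = S \<or> p = - S" for p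
    using that t by (intro mult_left_mono) (auto simp: B_def)
  have s': "s = S * t \<or> s = - S * t" "- s = S * t \<or> - s = - S * t"
    using s(2) by (auto simp: t_def abs_if)
  have "\<phi> s - \<phi> 0 \<le> t * B" "\<phi> (- s) - \<phi> 0 \<le> t * B"
    using s' chord[of S] chord[of "- S"] ends[of S] ends[of "- S"] by (metis order_trans)+
  then have "\<bar>\<phi> s - \<phi> 0\<bar> \<le> t * B"
    using reflect by (intro abs_leI) simp_all
  then show ?thesis by (simp add: t_def B_def)
qed

text \<open>
  The measures of the theorem. Balancedness is what makes the radial integral ignore linear functions.
\<close>

locale balanced_measure =
  fixes \<nu> :: "real measure"
  assumes compactly_supported: "\<nu> \<in> compactly_supported_measures"
    and finite_inverse: "(\<integral>\<^sup>+ s \<in> - {0}. ennreal (1 / \<bar>s\<bar>) \<partial>\<nu>) < \<infinity>"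
    and balanced: "(LINT s : - {0} | \<nu>. 1 / s) = 0"
begin

lemma sets_eq [simp, measurable_cong]: "sets \<nu> = sets borel"
  using compactly_supported by (simp add: compactly_supported_measures_def)

text \<open>
  The complement of the support is a union of open null sets, and countably many of them suffice by
  the Lindelof property.
\<close>

lemma AE_bounded: obtains S where "S > 0" "AE s in \<nu>. \<bar>s\<bar> \<le> S"
proof -
  have "bounded (measure_support \<nu>)"
    using compactly_supported by (simp add: compactly_supported_measures_def compact_imp_bounded)
  then obtain S where S: "S > 0" "\<And>s. s \<in> measure_support \<nu> \<Longrightarrow> \<bar>s\<bar> \<le> S"
    unfolding bounded_pos by auto
  define N where "N = {U. open U \<and> emeasure \<nu> U = 0}"
  obtain N' where N': "N' \<subseteq> N" "countable N'" "\<Union>N' = \<Union>N"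
    using Lindelof[of N] by (auto simp: N_def)
  have "\<Union>N' \<in> null_sets \<nu>"
    using N' by (intro null_sets_UN'[where N = id, simplified]) (auto simp: N_def null_sets_def)
  moreover have "{s \<in> space \<nu>. \<not> \<bar>s\<bar> \<le> S} \<subseteq> \<Union>N'"
  proof
    fix s assume "s \<in> {s \<in> space \<nu>. \<not> \<bar>s\<bar> \<le> S}"
    then have "s \<notin> measure_support \<nu>" using S(2) by auto
    then obtain U where "open U" "s \<in> U" "emeasure \<nu> U = 0"
      unfolding measure_support_def by (auto simp: zero_less_iff_neq_zero)
    then show "s \<in> \<Union>N'" unfolding N' by (auto simp: N_def)
  qed
  ultimately have "AE s in \<nu>. \<bar>s\<bar> \<le> S" by (rule AE_I')
  with S(1) that show thesis by blast
qed

lemma integrable_inverse: "set_integrable \<nu> (- {0}) (\<lambda>s. 1 / \<bar>s\<bar>)"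
  unfolding set_integrable_def
proof (rule integrableI_bounded)
  have "(\<integral>\<^sup>+ s. ennreal (norm (indicator (- {0}) s *\<^sub>R (1 / \<bar>s\<bar>))) \<partial>\<nu>) = (\<integral>\<^sup>+ s \<in> - {0}. ennreal (1 / \<bar>s\<bar>) \<partial>\<nu>)"
    by (intro nn_integral_cong) (simp split: split_indicator)
  then show "(\<integral>\<^sup>+ s. ennreal (norm (indicator (- {0}) s *\<^sub>R (1 / \<bar>s\<bar>))) \<partial>\<nu>) < \<infinity>"
    using finite_inverse by simp
qed measurable

lemma borel_measurable_convex:
  assumes "convex_on UNIV (\<phi> :: real \<Rightarrow> real)"
  shows "\<phi> \<in> borel_measurable borel"
  by (intro borel_measurable_continuous_onI convex_on_continuous assms) simp

lemma integrand_measurable: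
  assumes "convex_on UNIV \<phi>"
  shows "(\<lambda>s. indicator (- {0}) s *\<^sub>R ((\<phi> s - \<phi> 0) / \<bar>s\<bar> ^ 2)) \<in> borel_measurable \<nu>"
proof -
  note [measurable] = borel_measurable_convex[OF assms]
  show ?thesis by measurable
qed

lemma integrand_bound:
  assumes "convex_on UNIV \<phi>" "S > 0" "\<bar>s\<bar> \<le> S" "(\<bar>\<phi> S - \<phi> 0\<bar> + \<bar>\<phi> (- S) - \<phi> 0\<bar>) / S \<le> C"
  shows "norm (indicator (- {0}) s *\<^sub>R ((\<phi> s - \<phi> 0) / \<bar>s\<bar> ^ 2)) \<le> C * (indicator (- {0}) s *\<^sub>R (1 / \<bar>s\<bar>))"
proof (cases "s = 0")
  case False
  have "\<bar>\<phi> s - \<phi> 0\<bar> \<le> \<bar>s\<bar> * C"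
    using convex_increment_bound[OF assms(1,3,2)] mult_left_mono[OF assms(4), of "\<bar>s\<bar>"] by linarith
  then have "\<bar>\<phi> s - \<phi> 0\<bar> / \<bar>s\<bar> ^ 2 \<le> \<bar>s\<bar> * C / \<bar>s\<bar> ^ 2"
    by (rule divide_right_mono) simp
  also have "\<dots> = C * (1 / \<bar>s\<bar>)"
  proof -
    have "a * C / a ^ 2 = C * (1 / a)" for a :: real
      by (cases "a = 0") (simp_all add: power2_eq_square)
    then show ?thesis .
  qed
  finally show ?thesis using False by simp
qed simp

lemma integrable_integrand:
  assumes "convex_on UNIV \<phi>"
  shows "set_integrable \<nu> (- {0}) (\<lambda>s. (\<phi> s - \<phi> 0) / \<bar>s\<bar> ^ 2)"
proof -
  obtain S where S: "S > 0" "AE s in \<nu>. \<bar>s\<bar> \<le> S" by (rule AE_bounded)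
  have "AE s in \<nu>. norm (indicator (- {0}) s *\<^sub>R ((\<phi> s - \<phi> 0) / \<bar>s\<bar> ^ 2))
      \<le> (\<bar>\<phi> S - \<phi> 0\<bar> + \<bar>\<phi> (- S) - \<phi> 0\<bar>) / S * (indicator (- {0}) s *\<^sub>R (1 / \<bar>s\<bar>))"
    using S(2) by eventually_elim (rule integrand_bound[OF assms S(1) _ order_refl])
  moreover have "integrable \<nu> (\<lambda>s. (\<bar>\<phi> S - \<phi> 0\<bar> + \<bar>\<phi> (- S) - \<phi> 0\<bar>) / S * (indicator (- {0}) s *\<^sub>R (1 / \<bar>s\<bar>)))"
    using integrable_inverse unfolding set_integrable_def by (rule integrable_mult_right)
  ultimately show ?thesis
    unfolding set_integrable_def
    by (intro Bochner_Integration.integrable_bound[OF _ integrand_measurable[OF assms]])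
      (simp only:, erule eventually_mono, unfold real_norm_def, erule order_trans[OF _ abs_ge_self])
qed

lemma line_valuation_radial_integral: "line_valuation (radial_integral \<nu>)"
proof
  fix \<phi> \<psi> :: "real \<Rightarrow> real"
  assume cv: "convex_on UNIV \<phi>" "convex_on UNIV \<psi>" "convex_on UNIV (\<lambda>s. min (\<phi> s) (\<psi> s))"
  have "max x y - max x' y' + (min x y - min x' y') = (x - x') + (y - y')" for x y x' y' :: real
    by (simp add: max_def min_def)
  then have "(max x y - max x' y') / z + (min x y - min x' y') / z = (x - x') / z + (y - y') / z" for x y x' y' z :: real
    by (simp add: add_divide_distrib[symmetric])
  then show "radial_integral \<nu> (\<lambda>s. max (\<phi> s) (\<psi> s)) + radial_integral \<nu> (\<lambda>s. min (\<phi> s) (\<psi> s)) =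
      radial_integral \<nu> \<phi> + radial_integral \<nu> \<psi>"
    unfolding radial_integral_def
    using set_integral_add(2)[OF integrable_integrand[OF convex_on_max[OF cv(1,2)]] integrable_integrand[OF cv(3)]]
      set_integral_add(2)[OF integrable_integrand[OF cv(1)] integrable_integrand[OF cv(2)]]
    by simp
next
  fix \<phi> :: "real \<Rightarrow> real" and a b assume cv: "convex_on UNIV \<phi>"
  have "set_integrable \<nu> (- {0}) (\<lambda>s. 1 / s)"
    unfolding set_integrable_def
    by (rule Bochner_Integration.integrable_bound[OF integrable_inverse[unfolded set_integrable_def]])
      (auto split: split_indicator)
  then have lin: "set_integrable \<nu> (- {0}) (\<lambda>s. a * (1 / s))"
    by (rule set_integrable_mult_right)
  have "radial_integral \<nu> (\<lambda>s. \<phi> s + (a * s + b)) =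
      (LINT s : - {0} | \<nu>. (\<phi> s - \<phi> 0) / \<bar>s\<bar> ^ 2 + a * (1 / s))"
    unfolding radial_integral_def
    by (intro set_lebesgue_integral_cong) (auto simp: power2_eq_square add_divide_distrib diff_divide_distrib)
  also have "\<dots> = radial_integral \<nu> \<phi> + a * (LINT s : - {0} | \<nu>. 1 / s)"
    unfolding radial_integral_def set_integral_add(2)[OF integrable_integrand[OF cv] lin]
    by (simp only: set_integral_mult_right)
  finally show "radial_integral \<nu> (\<lambda>s. \<phi> s + (a * s + b)) = radial_integral \<nu> \<phi>"
    using balanced by simp
next
  fix F and \<phi> :: "real \<Rightarrow> real"
  assume cv: "\<And>k. convex_on UNIV (F k)" "convex_on UNIV \<phi>" and lim: "\<And>s. (\<lambda>k. F k s) \<longlonglongrightarrow> \<phi> s"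
  obtain S where S: "S > 0" "AE s in \<nu>. \<bar>s\<bar> \<le> S" by (rule AE_bounded)
  have "(\<lambda>k. (\<bar>F k S - F k 0\<bar> + \<bar>F k (- S) - F k 0\<bar>) / S) \<longlonglongrightarrow> (\<bar>\<phi> S - \<phi> 0\<bar> + \<bar>\<phi> (- S) - \<phi> 0\<bar>) / S"
    using S(1) by (intro tendsto_intros lim) simp
  then have "convergent (\<lambda>k. (\<bar>F k S - F k 0\<bar> + \<bar>F k (- S) - F k 0\<bar>) / S)"
    by (rule convergentI)
  then obtain C where C: "\<And>k. (\<bar>F k S - F k 0\<bar> + \<bar>F k (- S) - F k 0\<bar>) / S \<le> C"
    using Bseq_bdd_above[OF convergent_imp_Bseq] by (auto simp: bdd_above_def)
  show "(\<lambda>k. radial_integral \<nu> (F k)) \<longlonglongrightarrow> radial_integral \<nu> \<phi>"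
    unfolding radial_integral_def set_lebesgue_integral_def
  proof (rule integral_dominated_convergence)
    show "integrable \<nu> (\<lambda>s. C * (indicator (- {0}) s *\<^sub>R (1 / \<bar>s\<bar>)))"
      using integrable_inverse unfolding set_integrable_def by (rule integrable_mult_right)
    show "AE s in \<nu>. norm (indicator (- {0}) s *\<^sub>R ((F k s - F k 0) / \<bar>s\<bar> ^ 2)) \<le> C * (indicator (- {0}) s *\<^sub>R (1 / \<bar>s\<bar>))" for k
      using S(2) by eventually_elim (rule integrand_bound[OF cv(1) S(1) _ C])
    show "AE s in \<nu>. (\<lambda>k. indicator (- {0}) s *\<^sub>R ((F k s - F k 0) / \<bar>s\<bar> ^ 2))
        \<longlonglongrightarrow> indicator (- {0}) s *\<^sub>R ((\<phi> s - \<phi> 0) / \<bar>s\<bar> ^ 2)"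
    proof (rule AE_I2)
      show "(\<lambda>k. indicator (- {0}) s *\<^sub>R ((F k s - F k 0) / \<bar>s\<bar> ^ 2))
        \<longlonglongrightarrow> indicator (- {0}) s *\<^sub>R ((\<phi> s - \<phi> 0) / \<bar>s\<bar> ^ 2)" for s
        by (cases "s = 0") (auto intro!: tendsto_intros lim)
    qed
  qed (intro integrand_measurable cv)+
qed

end

text \<open>
  The substitution \<open>s = 1/r\<close>, combined with the density \<open>\<bar>s\<bar>\<close>, turns the radial integrand
  \<open>(x s - 1)\<^sub>+ / s\<^sup>2\<close> into \<open>\<bar>r\<bar> (x/r - 1)\<^sub>+\<close>, which is \<open>ramp x r\<close>, and \<open>1/\<bar>s\<bar>\<close> into \<open>1\<close>.
\<close>

lemma balanced_measure_of_ramps: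
  fixes m :: "real measure"
  assumes sets: "sets m = sets borel" and "finite_measure m" and \<delta>: "\<delta> > 0" "AE r in m. \<delta> \<le> \<bar>r\<bar>"
    and bal: "measure m {0<..} = measure m {..<0}"
  obtains \<nu> where "balanced_measure \<nu>"
    "\<And>x. radial_integral \<nu> (\<lambda>s. max 0 (x * s - 1)) = (\<integral>r. ramp x r \<partial>m)"
proof -
  interpret finite_measure m by fact
  note [measurable_cong] = sets
  define \<nu> where "\<nu> = density (distr m borel inverse) (\<lambda>s. ennreal \<bar>s\<bar>)"
  have sets_\<nu>: "sets \<nu> = sets borel" by (simp add: \<nu>_def)
  have nn: "(\<integral>\<^sup>+ s. f s \<partial>\<nu>) = (\<integral>\<^sup>+ r. ennreal \<bar>inverse r\<bar> * f (inverse r) \<partial>m)"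
    if [measurable]: "f \<in> borel_measurable borel" for f :: "real \<Rightarrow> ennreal"
    unfolding \<nu>_def by (simp add: nn_integral_density nn_integral_distr)
  have int: "(\<integral>s. f s \<partial>\<nu>) = (\<integral>r. \<bar>inverse r\<bar> * f (inverse r) \<partial>m)"
    if [measurable]: "f \<in> borel_measurable borel" for f :: "real \<Rightarrow> real"
    unfolding \<nu>_def by (simp add: integral_density integral_distr)
  have inv: "AE r in m. r \<noteq> 0 \<and> \<bar>inverse r\<bar> \<le> 1 / \<delta>"
    using \<delta>(2) by eventually_elim (use \<delta>(1) in \<open>auto simp: field_simps\<close>)
  have emeasure_\<nu>: "emeasure \<nu> A = (\<integral>\<^sup>+ r. ennreal \<bar>inverse r\<bar> * indicator A (inverse r) \<partial>m)" if "A \<in> sets borel" for A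
    using nn[of "indicator A"] that sets_\<nu> by simp
  have "finite_measure \<nu>"
  proof
    have "emeasure \<nu> (space \<nu>) \<le> (\<integral>\<^sup>+ r. ennreal (1 / \<delta>) \<partial>m)"
    proof (subst emeasure_\<nu>)
      show "(\<integral>\<^sup>+ r. ennreal \<bar>inverse r\<bar> * indicator (space \<nu>) (inverse r) \<partial>m) \<le> (\<integral>\<^sup>+ r. ennreal (1 / \<delta>) \<partial>m)"
        by (intro nn_integral_mono_AE eventually_mono[OF inv]) (auto simp: \<nu>_def intro!: ennreal_leI)
    qed (simp add: \<nu>_def)
    also have "\<dots> < \<infinity>"
      by (simp add: ennreal_mult_eq_top_iff less_top[symmetric])
    finally show "emeasure \<nu> (space \<nu>) \<noteq> \<infinity>" by simp
  qed
  moreover have "compact (measure_support \<nu>)"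
  proof -
    have "- measure_support \<nu> = \<Union>{U. open U \<and> emeasure \<nu> U = 0}"
      unfolding measure_support_def by (auto simp: zero_less_iff_neq_zero)
    then have "closed (measure_support \<nu>)"
      unfolding closed_def by (auto intro: open_Union)
    moreover have "measure_support \<nu> \<subseteq> cball 0 (1 / \<delta>)"
    proof (rule ccontr)
      assume "\<not> ?thesis"
      then obtain s where "s \<in> measure_support \<nu>" "s \<notin> cball 0 (1 / \<delta>)"
        by blast
      then have s: "s \<in> measure_support \<nu>" "1 / \<delta> < \<bar>s\<bar>"
        by simp_all
      have "open {s::real. 1 / \<delta> < \<bar>s\<bar>}"
        by (intro open_Collect_less continuous_intros)
      moreover have "emeasure \<nu> {s. 1 / \<delta> < \<bar>s\<bar>} = 0"
      proof (subst emeasure_\<nu>)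
        have "(\<integral>\<^sup>+ r. ennreal \<bar>inverse r\<bar> * indicator {s. 1 / \<delta> < \<bar>s\<bar>} (inverse r) \<partial>m) = (\<integral>\<^sup>+ r. 0 \<partial>m)"
          by (intro nn_integral_cong_AE eventually_mono[OF inv]) (auto split: split_indicator)
        then show "(\<integral>\<^sup>+ r. ennreal \<bar>inverse r\<bar> * indicator {s. 1 / \<delta> < \<bar>s\<bar>} (inverse r) \<partial>m) = 0"
          by simp
      qed measurable
      ultimately show False
        using s unfolding measure_support_def by force
    qed
    ultimately show ?thesis
      using bounded_cball bounded_subset compact_eq_bounded_closed by blast
  qed
  ultimately have "\<nu> \<in> compactly_supported_measures"
    using sets_\<nu> by (simp add: compactly_supported_measures_def)
  moreover have "(\<integral>\<^sup>+ s \<in> - {0}. ennreal (1 / \<bar>s\<bar>) \<partial>\<nu>) < \<infinity>"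
  proof -
    have "ennreal \<bar>inverse r\<bar> * (ennreal (1 / \<bar>inverse r\<bar>) * indicator (- {0}) (inverse r)) \<le> 1" for r
      by (cases "r = 0") (simp_all flip: ennreal_mult)
    then have "(\<integral>\<^sup>+ s \<in> - {0}. ennreal (1 / \<bar>s\<bar>) \<partial>\<nu>) \<le> (\<integral>\<^sup>+ r. 1 \<partial>m)"
      by (subst nn) (measurable, intro nn_integral_mono)
    also have "\<dots> < \<infinity>"
      by (simp add: less_top[symmetric])
    finally show ?thesis .
  qed
  moreover have "(LINT s : - {0} | \<nu>. 1 / s) = 0"
  proof -
    have "(LINT s : - {0} | \<nu>. 1 / s) = (\<integral>r. indicator {0<..} r - indicator {..<0} r \<partial>m)"
      unfolding set_lebesgue_integral_def
      by (subst int) (auto intro!: Bochner_Integration.integral_cong split: split_indicator)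
    also have "\<dots> = measure m {0<..} - measure m {..<0}"
      by (subst Bochner_Integration.integral_diff) (auto simp: sets emeasure_eq_measure)
    finally show ?thesis using bal by simp
  qed
  moreover have "radial_integral \<nu> (\<lambda>s. max 0 (x * s - 1)) = (\<integral>r. ramp x r \<partial>m)" for x
  proof -
    have "radial_integral \<nu> (\<lambda>s. max 0 (x * s - 1)) =
      (\<integral>r. \<bar>inverse r\<bar> * (indicator (- {0}) (inverse r) *\<^sub>R ((max 0 (x * inverse r - 1) - max 0 (x * 0 - 1)) / \<bar>inverse r\<bar> ^ 2)) \<partial>m)"
      unfolding radial_integral_def set_lebesgue_integral_def by (subst int) simp_all
    also have "\<dots> = (\<integral>r. ramp x r \<partial>m)"
    proof (rule integral_cong_AE)
      have eq: "\<bar>inverse r\<bar> * (max 0 (x * inverse r - 1) / \<bar>inverse r\<bar> ^ 2) = ramp x r" if "r \<noteq> 0" for r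
        using that by (auto simp: ramp_def max_def field_simps power2_eq_square abs_if)
      show "AE r in m. \<bar>inverse r\<bar> * (indicator (- {0}) (inverse r) *\<^sub>R ((max 0 (x * inverse r - 1) - max 0 (x * 0 - 1)) / \<bar>inverse r\<bar> ^ 2)) = ramp x r"
        using inv by eventually_elim (use eq in simp)
    qed measurable
    finally show ?thesis .
  qed
  ultimately show thesis
    using that by (simp add: balanced_measure_def)
qed

text \<open>
  The hypothesis is the trace of convexity of \<open>\<Psi> f\<close>: it is applied to one hinge only, where it says
  that \<open>h x = \<bar>x\<bar> * hinge_value (1 / x)\<close> is convex. The measure is read off from \<open>h\<close>, and the difference of
  the two sides is again a valuation, one that vanishes on all hinges.
\<close>

theorem (in line_valuation) radial_representation:
  assumes dilate: "\<And>\<phi>. convex_on UNIV \<phi> \<Longrightarrow> convex_on UNIV (\<lambda>x. \<mu> (\<lambda>s. \<phi> (x * s)))"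
  obtains \<nu> where "balanced_measure \<nu>"
    "\<And>\<phi>. convex_on UNIV \<phi> \<Longrightarrow> \<mu> \<phi> = \<mu> (\<lambda>_. 0) + radial_integral \<nu> \<phi>"
proof -
  define h where "h x = \<mu> (\<lambda>s. max 0 (x * s - 1)) - \<mu> (\<lambda>_. 0)" for x
  have h: "h x = \<bar>x\<bar> * hinge_value (1 / x)" for x
    unfolding h_def by (rule pos_part_value)
  have cv: "convex_on UNIV h"
    using dilate[OF convex_on_pos_part[of 1 "- 1"]]
    unfolding h_def by (intro convex_on_diff) (simp_all add: concave_on_const)
  obtain S where S: "S > 0" "\<And>t. S < \<bar>t\<bar> \<Longrightarrow> hinge_value t = 0"
    using hinge_value_compact_support by blast
  have pos: "0 < 1 / S" using S(1) by simp
  have zero: "h x = 0" if "\<bar>x\<bar> < 1 / S" for x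
  proof (cases "x = 0")
    case False
    then have "S < \<bar>1 / x\<bar>" using that S(1) by (simp add: field_simps)
    then show ?thesis using S(2) h by simp
  qed (simp add: h)
  have cont: "isCont hinge_value 0"
    using hinge_value_tendsto by (simp add: continuous_at_sequentially o_def)
  have inv: "((\<lambda>x::real. 1 / x) \<longlongrightarrow> 0) at_top" "((\<lambda>x::real. 1 / x) \<longlongrightarrow> 0) at_bot"
    by (intro tendsto_divide_0[OF tendsto_const] filterlim_at_top_imp_at_infinity
        filterlim_at_bot_imp_at_infinity filterlim_ident)+
  have top: "((\<lambda>x. h x / x) \<longlongrightarrow> hinge_value 0) at_top"
  proof (rule Lim_transform_eventually)
    show "((\<lambda>x. hinge_value (1 / x)) \<longlongrightarrow> hinge_value 0) at_top"
      by (rule isCont_tendsto_compose[OF cont inv(1)])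
    show "\<forall>\<^sub>F x in at_top. hinge_value (1 / x) = h x / x"
      using eventually_gt_at_top[of 0] by (rule eventually_mono) (simp add: h)
  qed
  have bot: "((\<lambda>x. h x / x) \<longlongrightarrow> - hinge_value 0) at_bot"
  proof (rule Lim_transform_eventually)
    show "((\<lambda>x. - hinge_value (1 / x)) \<longlongrightarrow> - hinge_value 0) at_bot"
      by (intro tendsto_minus isCont_tendsto_compose[OF cont inv(2)])
    show "\<forall>\<^sub>F x in at_bot. - hinge_value (1 / x) = h x / x"
      using eventually_gt_at_bot[of 0] by (rule eventually_mono) (simp add: h)
  qed
  obtain m :: "real measure" where m: "sets m = sets borel" "finite_measure m"
    "AE r in m. 1 / S / 2 \<le> \<bar>r\<bar>" "measure m {0<..} = measure m {..<0}" "\<And>x. h x = (\<integral>r. ramp x r \<partial>m)"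
    using convex_eq_integral_ramp[OF cv pos zero top bot] by blast
  obtain \<nu> where \<nu>: "balanced_measure \<nu>"
    "\<And>x. radial_integral \<nu> (\<lambda>s. max 0 (x * s - 1)) = h x"
    using balanced_measure_of_ramps[OF m(1,2) _ m(3,4)] S(1) m(5) by auto
  interpret R: line_valuation "radial_integral \<nu>"
    using \<nu>(1) by (rule balanced_measure.line_valuation_radial_integral)
  have R0: "radial_integral \<nu> (\<lambda>_. 0) = 0"
    by (simp add: radial_integral_def)
  interpret \<Delta>: line_valuation "\<lambda>\<phi>. \<mu> \<phi> - \<mu> (\<lambda>_. 0) - radial_integral \<nu> \<phi>"
  proof
    fix \<phi> \<psi> :: "real \<Rightarrow> real"
    assume "convex_on UNIV \<phi>" "convex_on UNIV \<psi>" "convex_on UNIV (\<lambda>s. min (\<phi> s) (\<psi> s))"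
    from valuation[OF this] R.valuation[OF this]
    show "\<mu> (\<lambda>s. max (\<phi> s) (\<psi> s)) - \<mu> (\<lambda>_. 0) - radial_integral \<nu> (\<lambda>s. max (\<phi> s) (\<psi> s)) +
        (\<mu> (\<lambda>s. min (\<phi> s) (\<psi> s)) - \<mu> (\<lambda>_. 0) - radial_integral \<nu> (\<lambda>s. min (\<phi> s) (\<psi> s))) =
        \<mu> \<phi> - \<mu> (\<lambda>_. 0) - radial_integral \<nu> \<phi> + (\<mu> \<psi> - \<mu> (\<lambda>_. 0) - radial_integral \<nu> \<psi>)"
      by simp
  qed (simp_all add: add_affine R.add_affine, intro tendsto_intros continuous R.continuous)
  have away: "\<Delta>.hinge_value t = 0" if "t \<noteq> 0" for t
    using \<Delta>.pos_part_value[of "1 / t"] that \<nu>(2)[of "1 / t"] R0 by (simp add: h_def)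
  have "\<Delta>.hinge_value t = 0" for t
  proof (cases "t = 0")
    case True
    \<comment> \<open>The functions \<open>(x s - 1)\<^sub>+\<close> miss the hinge at \<open>0\<close>, which is reached by continuity.\<close>
    have "(\<lambda>n. \<Delta>.hinge_value (1 / real (Suc n))) \<longlonglongrightarrow> \<Delta>.hinge_value 0"
      by (intro \<Delta>.hinge_value_tendsto LIMSEQ_Suc lim_1_over_n)
    then show ?thesis
      using True away by (simp add: LIMSEQ_const_iff del: of_nat_Suc)
  qed (rule away)
  then have "\<mu> \<phi> - \<mu> (\<lambda>_. 0) - radial_integral \<nu> \<phi> = 0" if "convex_on UNIV \<phi>" for \<phi>
    using \<Delta>.eq_zero_if_hinges_vanish[OF _ _ that] R0 by simp
  then have "\<mu> \<phi> = \<mu> (\<lambda>_. 0) + radial_integral \<nu> \<phi>" if "convex_on UNIV \<phi>" for \<phi>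
    using that by (metis add.commute diff_add_cancel diff_zero)
  with \<nu>(1) that show thesis by blast
qed

section \<open>Equivariant endomorphisms of the space of convex functions\<close>

text \<open>
  The shear arises from the identity matrix by adding a combination of the other rows to row \<open>i\<close>.
\<close>

lemma SL_shear:
  fixes w :: "real ^ 'n" and i :: 'n
  assumes "w \<bullet> axis i 1 = 0"
  obtains A :: "real ^ 'n ^ 'n" where "det A = 1" "\<And>z. A *v z = z + (w \<bullet> z) *\<^sub>R axis i 1"
proof -
  have wi: "w $ i = 0" using assms by (simp add: inner_axis)
  have row1: "row k (mat 1 :: real ^ 'n ^ 'n) = axis k 1" for k
    by (simp add: row_def mat_def axis_def vec_eq_iff)
  define A :: "real ^ 'n ^ 'n" where "A = (\<chi> k. if k = i then row i (mat 1) + w else row k (mat 1))"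
  have "w = (\<Sum>j\<in>UNIV. w $ j *s axis j 1)"
    by (rule basis_expansion[symmetric])
  moreover have "w $ j *s axis j 1 \<in> vec.span {row j (mat 1 :: real ^ 'n ^ 'n) |j. j \<noteq> i}" for j
  proof (cases "j = i")
    case True
    then show ?thesis using wi vec.span_zero by simp
  next
    case False
    then show ?thesis by (intro vec.span_scale vec.span_base) (auto simp: row1)
  qed
  ultimately have "w \<in> vec.span {row j (mat 1 :: real ^ 'n ^ 'n) |j. j \<noteq> i}"
    by (metis (no_types, lifting) vec.span_sum)
  then have "det A = 1"
    unfolding A_def by (simp add: det_row_span)
  moreover have "A *v z = z + (w \<bullet> z) *\<^sub>R axis i 1" for z
  proof -
    have "(A *v z) $ k = (A $ k) \<bullet> z" for k
      by (simp add: matrix_vector_mult_def inner_vec_def)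
    then have "(A *v z) $ k = z $ k + (w \<bullet> z) * axis i 1 $ k" for k
      by (cases "k = i") (simp_all add: A_def row1 inner_add_left inner_axis', simp_all add: axis_def)
    then show ?thesis by (simp add: vec_eq_iff)
  qed
  ultimately show thesis by (rule that)
qed

lemma SL_stretch:
  fixes i j :: "'n::finite" and t :: real
  assumes "i \<noteq> j" "t \<noteq> 0"
  obtains A :: "real ^ 'n ^ 'n" where "det A = 1" "\<And>z. (A *v z) $ i = t * z $ i" "A *v axis i 1 = t *\<^sub>R axis i 1"
proof -
  define d where "d k = (if k = i then t else if k = j then 1 / t else 1)" for k
  define A :: "real ^ 'n ^ 'n" where "A = (\<chi> k l. if k = l then d k else 0)"
  have "det A = (\<Prod>k\<in>UNIV. d k)"
    by (subst det_diagonal) (simp_all add: A_def)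
  also have "\<dots> = d i * (d j * (\<Prod>k\<in>UNIV - {i} - {j}. d k))"
    using assms by (subst prod.remove[of _ i], simp, simp, subst prod.remove[of _ j]) auto
  also have "(\<Prod>k\<in>UNIV - {i} - {j}. d k) = 1"
    by (intro prod.neutral) (simp add: d_def)
  finally have "det A = 1"
    using assms by (simp add: d_def)
  moreover have Az: "(A *v z) $ k = d k * z $ k" for z k
    by (simp add: A_def matrix_vector_mult_def if_distrib if_distribR cong: if_cong)
  moreover have "A *v axis i 1 = t *\<^sub>R axis i 1"
    by (simp add: vec_eq_iff Az) (simp add: axis_def d_def)
  ultimately show thesis by (intro that) (simp_all add: d_def)
qed

lemma exists_other_index:
  fixes i :: "'n::finite"
  assumes "CARD('n) \<ge> 2"
  shows "\<exists>j. i \<noteq> j"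
proof (rule ccontr)
  assume "\<not> ?thesis"
  then have "UNIV = {i}" by auto
  then show False using assms by (metis card.empty card.insert empty_iff finite.emptyI not_less_eq_eq numeral_2_eq_2 order_refl)
qed

text \<open>
  Stretch the axis to the length of \<open>x\<close>, then rotate.
\<close>

lemma SL_transitive:
  fixes i :: "'n::finite" and x :: "real ^ 'n"
  assumes "CARD('n) \<ge> 2" "x \<noteq> 0"
  obtains A :: "real ^ 'n ^ 'n" where "det A = 1" "A *v axis i 1 = x"
proof -
  obtain j :: 'n where "i \<noteq> j"
    using exists_other_index[OF assms(1)] by blast
  then obtain S :: "real ^ 'n ^ 'n" where S: "det S = 1" "S *v axis i 1 = norm x *\<^sub>R axis i 1"
    using SL_stretch[of i j "norm x"] assms(2) by (metis norm_eq_zero)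
  obtain R where R: "orthogonal_transformation R" "det (matrix R) = 1" "R (norm x *\<^sub>R axis i 1) = x"
    using rotation_exists[OF assms(1), of "norm x *\<^sub>R axis i 1" x] by (auto simp: norm_axis_1)
  have "linear R" using R(1) by (simp add: orthogonal_transformation)
  then have "(matrix R ** S) *v axis i 1 = x"
    using S(2) R(3) by (simp add: matrix_vector_mul_assoc[symmetric] matrix_works)
  moreover have "det (matrix R ** S) = 1"
    using R(2) S(1) by (simp add: det_mul)
  ultimately show thesis using that by blast
qed

lemma Conv_iff: "f \<in> Conv \<longleftrightarrow> convex_on UNIV f"
  by (simp add: Conv_def)

lemma convex_on_ray:
  assumes "convex_on UNIV f"
  shows "convex_on UNIV (\<lambda>s::real. f (s *\<^sub>R x))"
  by (rule convex_on_compose_linear[OF assms]) (simp add: linearI scaleR_left_distrib)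

lemma convex_on_coordinate:
  assumes "convex_on UNIV \<phi>"
  shows "convex_on UNIV (\<lambda>z :: real ^ 'n. \<phi> (z $ i))"
  by (rule convex_on_compose_linear[OF assms]) (simp add: linearI)

lemma convex_on_compose_matrix:
  fixes A :: "real ^ 'n ^ 'm"
  assumes "convex_on UNIV f"
  shows "convex_on UNIV (\<lambda>z. f (A *v z))"
  by (rule convex_on_compose_linear[OF assms]) (rule matrix_vector_mul_linear)

text \<open>
  The preimage of the set of functions whose value at \<open>x\<close> is close to \<open>\<Psi> f x\<close> is sequentially open.
\<close>

lemma continuous_map_imp_pointwise_limit:
  fixes \<Psi> :: "(real ^ 'n \<Rightarrow> real) \<Rightarrow> (real ^ 'n \<Rightarrow> real)"
  assumes \<Psi>: "continuous_map epi_topology epi_topology \<Psi>"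
    and F: "\<And>k. F k \<in> Conv" "f \<in> Conv" "\<And>z. (\<lambda>k. F k z) \<longlonglongrightarrow> f z"
  shows "(\<lambda>k. \<Psi> (F k) x) \<longlonglongrightarrow> \<Psi> f x"
proof (rule tendstoI)
  fix \<epsilon> :: real assume \<epsilon>: "\<epsilon> > 0"
  define U where "U = {g \<in> Conv. dist (g x) (\<Psi> f x) < \<epsilon>}"
  have "epi_open U"
    unfolding epi_open_def
  proof (intro conjI ballI allI impI)
    fix g G assume "g \<in> U" and G: "range G \<subseteq> Conv \<and> epi_converges G g"
    then have Gc: "\<And>k. G k \<in> Conv" by auto
    then have "(\<lambda>k. G k x) \<longlonglongrightarrow> g x"
      using G epi_converges_iff_pointwise[of G g] by blast
    then have "(\<lambda>k. dist (G k x) (\<Psi> f x)) \<longlonglongrightarrow> dist (g x) (\<Psi> f x)"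
      by (intro tendsto_intros)
    moreover have "dist (g x) (\<Psi> f x) < \<epsilon>"
      using \<open>g \<in> U\<close> by (simp add: U_def)
    ultimately have "\<forall>\<^sub>F k in sequentially. dist (G k x) (\<Psi> f x) < \<epsilon>"
      by (rule order_tendstoD(2))
    then show "\<forall>\<^sub>F k in sequentially. G k \<in> U"
      by (rule eventually_mono) (simp add: U_def Gc)
  qed (auto simp: U_def)
  then have "openin epi_topology {g \<in> topspace epi_topology. \<Psi> g \<in> U}"
    by (intro openin_continuous_map_preimage[OF \<Psi>]) (simp add: openin_epi_topology)
  then have "epi_open {g \<in> Conv. \<Psi> g \<in> U}"
    by (simp add: openin_epi_topology topspace_epi_topology)
  moreover have "f \<in> {g \<in> Conv. \<Psi> g \<in> U}"
    using \<Psi> F(2) \<epsilon> by (auto simp: U_def continuous_map_def topspace_epi_topology)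
  moreover have "range F \<subseteq> Conv \<and> epi_converges F f"
    using F epi_converges_iff_pointwise[of F f] by auto
  ultimately have "\<forall>\<^sub>F k in sequentially. F k \<in> {g \<in> Conv. \<Psi> g \<in> U}"
    unfolding epi_open_def by blast
  then show "\<forall>\<^sub>F k in sequentially. dist (\<Psi> (F k) x) (\<Psi> f x) < \<epsilon>"
    by (rule eventually_mono) (simp add: U_def)
qed

lemma continuous_map_if_pointwise_limit:
  fixes \<Psi> :: "(real ^ 'n \<Rightarrow> real) \<Rightarrow> (real ^ 'n \<Rightarrow> real)"
  assumes \<Psi>: "\<Psi> \<in> Conv \<rightarrow> Conv"
    and lim: "\<And>F f x. (\<And>k. F k \<in> Conv) \<Longrightarrow> f \<in> Conv \<Longrightarrow> (\<And>z. (\<lambda>k. F k z) \<longlonglongrightarrow> f z) \<Longrightarrow>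
      (\<lambda>k. \<Psi> (F k) x) \<longlonglongrightarrow> \<Psi> f x"
  shows "continuous_map epi_topology epi_topology \<Psi>"
  unfolding continuous_map_def topspace_epi_topology openin_epi_topology
proof (intro conjI allI impI \<Psi>)
  fix U :: "(real ^ 'n \<Rightarrow> real) set"
  assume U: "epi_open U"
  show "epi_open {f \<in> Conv. \<Psi> f \<in> U}"
    unfolding epi_open_def
  proof (intro conjI ballI allI impI)
    fix f F assume f: "f \<in> {f \<in> Conv. \<Psi> f \<in> U}" and F: "range F \<subseteq> Conv \<and> epi_converges F f"
    have Fc: "F k \<in> Conv" for k using F by auto
    then have \<Psi>F: "\<Psi> (F k) \<in> Conv" for k using \<Psi> by auto
    have "(\<lambda>k. F k z) \<longlonglongrightarrow> f z" for z
      using F epi_converges_iff_pointwise[of F f, OF Fc] by blast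
    then have "(\<lambda>k. \<Psi> (F k) x) \<longlonglongrightarrow> \<Psi> f x" for x
      using lim[of F f x, OF Fc] f by blast
    then have "epi_converges (\<lambda>k. \<Psi> (F k)) (\<Psi> f)"
      using epi_converges_iff_pointwise[of "\<lambda>k. \<Psi> (F k)", OF \<Psi>F] by blast
    moreover have sub: "\<forall>\<^sub>F k in sequentially. G k \<in> U" if "g \<in> U" "range G \<subseteq> Conv" "epi_converges G g" for g G
      using U that unfolding epi_open_def by blast
    ultimately have "\<forall>\<^sub>F k in sequentially. \<Psi> (F k) \<in> U"
      using f \<Psi>F by (intro sub[of "\<Psi> f"]) auto
    then show "\<forall>\<^sub>F k in sequentially. F k \<in> {f \<in> Conv. \<Psi> f \<in> U}"
      by (rule eventually_mono) (simp add: Fc)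
  qed auto
qed

locale SL_endomorphism =
  fixes \<Psi> :: "(real ^ 'n \<Rightarrow> real) \<Rightarrow> (real ^ 'n \<Rightarrow> real)"
  assumes dim: "CARD('n) \<ge> 2" and maps: "\<Psi> \<in> Conv \<rightarrow> Conv"
    and continuous: "continuous_map epi_topology epi_topology \<Psi>"
    and valuation: "valuation \<Psi>"
    and invariant: "dually_epi_translation_invariant \<Psi>"
    and equivariant: "SL_equivariant \<Psi>"
begin

lemma limit:
  "(\<And>k. convex_on UNIV (F k)) \<Longrightarrow> convex_on UNIV f \<Longrightarrow> (\<And>z. (\<lambda>k. F k z) \<longlonglongrightarrow> f z) \<Longrightarrow>
    (\<lambda>k. \<Psi> (F k) x) \<longlonglongrightarrow> \<Psi> f x"
  using continuous_map_imp_pointwise_limit[OF continuous, of F f x] by (simp add: Conv_iff)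

lemma max_min:
  "convex_on UNIV f \<Longrightarrow> convex_on UNIV h \<Longrightarrow> convex_on UNIV (\<lambda>z. min (f z) (h z)) \<Longrightarrow>
    \<Psi> (\<lambda>z. max (f z) (h z)) x + \<Psi> (\<lambda>z. min (f z) (h z)) x = \<Psi> f x + \<Psi> h x"
  using valuation unfolding valuation_def Ball_def Conv_iff by blast

lemma add_affine: "convex_on UNIV f \<Longrightarrow> linear L \<Longrightarrow> \<Psi> (\<lambda>z. f z + (L z + b)) = \<Psi> f"
  using invariant unfolding dually_epi_translation_invariant_def Ball_def Conv_iff by blast

lemma compose_SL: "convex_on UNIV f \<Longrightarrow> det A = 1 \<Longrightarrow> \<Psi> (\<lambda>z. f (A *v z)) x = \<Psi> f (A *v x)"
  using equivariant unfolding SL_equivariant_def Ball_def Conv_iff by metis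

lemma continuous_value:
  assumes "convex_on UNIV f" "X \<longlonglongrightarrow> x"
  shows "(\<lambda>k. \<Psi> f (X k)) \<longlonglongrightarrow> \<Psi> f x"
proof -
  have "convex_on UNIV (\<Psi> f)"
    using maps assms(1) by (auto simp: Conv_iff)
  then have "isCont (\<Psi> f) x"
    by (rule convex_on_imp_isCont)
  then show ?thesis using assms(2) by (rule isCont_tendsto_compose)
qed

lemma shear_invariant_valuation_at_axis: "shear_invariant_valuation (\<lambda>f. \<Psi> f (axis i 1)) (axis i 1)"
proof
  show "norm (axis i (1::real) :: real ^ 'n) = 1" by (rule norm_axis_1)
next
  fix f :: "real ^ 'n \<Rightarrow> real" and a b assume "convex_on UNIV f"
  then show "\<Psi> (\<lambda>z. f z + (a \<bullet> z + b)) (axis i 1) = \<Psi> f (axis i 1)"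
    using add_affine[of f "\<lambda>z. a \<bullet> z" b] by (simp add: bounded_linear.linear bounded_linear_inner_right)
next
  fix f :: "real ^ 'n \<Rightarrow> real" and w :: "real ^ 'n" assume f: "convex_on UNIV f" and w: "w \<bullet> axis i 1 = 0"
  obtain A where A: "det A = 1" "\<And>z. A *v z = z + (w \<bullet> z) *\<^sub>R axis i 1"
    using SL_shear[OF w] by blast
  show "\<Psi> (\<lambda>z. f (z + (w \<bullet> z) *\<^sub>R axis i 1)) (axis i 1) = \<Psi> f (axis i 1)"
    using compose_SL[OF f A(1), of "axis i 1"] w by (simp add: A(2))
qed (intro max_min limit; assumption)+

text \<open>
  The one-dimensional valuation behind \<open>\<Psi>\<close>: a function of one variable is spread over \<open>\<real>\<^sup>n\<close> as a ridge
  function of the coordinate \<open>i\<close>.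
\<close>

definition profile :: "'n \<Rightarrow> (real \<Rightarrow> real) \<Rightarrow> real" where
  "profile i \<phi> = \<Psi> (\<lambda>z. \<phi> (z $ i)) (axis i 1)"

lemma line_valuation_profile: "line_valuation (profile i)"
proof
  fix \<phi> \<psi> :: "real \<Rightarrow> real"
  assume "convex_on UNIV \<phi>" "convex_on UNIV \<psi>" "convex_on UNIV (\<lambda>s. min (\<phi> s) (\<psi> s))"
  then show "profile i (\<lambda>s. max (\<phi> s) (\<psi> s)) + profile i (\<lambda>s. min (\<phi> s) (\<psi> s)) = profile i \<phi> + profile i \<psi>"
    unfolding profile_def by (intro max_min convex_on_coordinate[of _ i] convex_on_coordinate[of "\<lambda>s. min (\<phi> s) (\<psi> s)" i])
next
  fix \<phi> :: "real \<Rightarrow> real" and a b assume "convex_on UNIV \<phi>"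
  then show "profile i (\<lambda>s. \<phi> s + (a * s + b)) = profile i \<phi>"
    unfolding profile_def
    by (subst add_affine[where L = "\<lambda>z. a * z $ i"]) (auto intro!: convex_on_coordinate linearI simp: algebra_simps)
next
  fix F and \<phi> :: "real \<Rightarrow> real"
  assume "\<And>k. convex_on UNIV (F k)" "convex_on UNIV \<phi>" "\<And>s. (\<lambda>k. F k s) \<longlonglongrightarrow> \<phi> s"
  then show "(\<lambda>k. profile i (F k)) \<longlonglongrightarrow> profile i \<phi>"
    unfolding profile_def by (intro limit convex_on_coordinate)
qed

text \<open>
  For \<open>t \<noteq> 0\<close> a matrix stretching the axis \<open>i\<close> by \<open>t\<close>, with determinant \<open>1\<close> thanks to a second
  coordinate, dilates the ridge function; \<open>t = 0\<close> is a limit on both sides.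
\<close>

lemma profile_dilate:
  assumes \<phi>: "convex_on UNIV \<phi>"
  shows "profile i (\<lambda>s. \<phi> (t * s)) = \<Psi> (\<lambda>z. \<phi> (z $ i)) (t *\<^sub>R axis i 1)"
proof -
  note cv = convex_on_coordinate[OF \<phi>, of i]
  have dil: "convex_on UNIV (\<lambda>s. \<phi> (t * s))" for t
    using convex_on_ray[OF \<phi>, of t] by (simp add: mult.commute)
  obtain j :: 'n where j: "i \<noteq> j"
    using exists_other_index[OF dim] by blast
  have nonzero: "profile i (\<lambda>s. \<phi> (t * s)) = \<Psi> (\<lambda>z. \<phi> (z $ i)) (t *\<^sub>R axis i 1)" if "t \<noteq> 0" for t
  proof -
    obtain A :: "real ^ 'n ^ 'n" where A: "det A = 1" "\<And>z. (A *v z) $ i = t * z $ i" "A *v axis i 1 = t *\<^sub>R axis i 1"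
      using SL_stretch[OF j \<open>t \<noteq> 0\<close>] by blast
    show ?thesis
      using compose_SL[OF cv A(1), of "axis i 1"] by (simp add: A(2,3) profile_def)
  qed
  show ?thesis
  proof (cases "t = 0")
    case True
    interpret line_valuation "profile i" by (rule line_valuation_profile)
    have inv: "(\<lambda>k. 1 / real (Suc k)) \<longlonglongrightarrow> 0"
      by (intro LIMSEQ_Suc lim_1_over_n)
    have cont: "isCont \<phi> 0"
      by (rule convex_on_imp_isCont[OF \<phi>])
    have "(\<lambda>k. profile i (\<lambda>s. \<phi> (1 / real (Suc k) * s))) \<longlonglongrightarrow> profile i (\<lambda>s. \<phi> (0 * s))"
    proof (intro continuous dil)
      show "(\<lambda>k. \<phi> (1 / real (Suc k) * s)) \<longlonglongrightarrow> \<phi> (0 * s)" for s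
        using isCont_tendsto_compose[OF cont, of "\<lambda>k. 1 / real (Suc k) * s"] tendsto_mult_left_zero[OF inv, of s] by simp
    qed
    moreover have "profile i (\<lambda>s. \<phi> (1 / real (Suc k) * s)) = \<Psi> (\<lambda>z. \<phi> (z $ i)) ((1 / real (Suc k)) *\<^sub>R axis i 1)" for k
      by (rule nonzero) simp
    moreover have "(\<lambda>k. \<Psi> (\<lambda>z. \<phi> (z $ i)) ((1 / real (Suc k)) *\<^sub>R axis i 1)) \<longlonglongrightarrow> \<Psi> (\<lambda>z. \<phi> (z $ i)) (0 *\<^sub>R axis i 1)"
      by (intro continuous_value cv tendsto_scaleR inv tendsto_const)
    ultimately show ?thesis
      unfolding True by (simp only: LIMSEQ_unique)
  qed (rule nonzero)
qed

text \<open>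
  Move \<open>x\<close> to the axis \<open>i\<close> by a matrix of determinant \<open>1\<close>. There the function may be replaced by the ridge function
  with the same restriction to the axis.
\<close>

lemma value_eq_profile:
  assumes f: "convex_on UNIV f" and x: "x \<noteq> 0"
  shows "\<Psi> f x = profile i (\<lambda>s. f (s *\<^sub>R x))"
proof -
  interpret shear_invariant_valuation "\<lambda>f. \<Psi> f (axis i 1)" "axis i 1"
    by (rule shear_invariant_valuation_at_axis)
  obtain A :: "real ^ 'n ^ 'n" where A: "det A = 1" "A *v axis i 1 = x"
    using SL_transitive[OF dim x] by blast
  have "\<Psi> f x = \<Psi> (\<lambda>z. f (A *v z)) (axis i 1)"
    using compose_SL[OF f A(1)] A(2) by simp
  also have "\<dots> = profile i (\<lambda>s. f (s *\<^sub>R x))"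
    unfolding profile_def
  proof (rule eq_if_eq_on_axis)
    show "f (A *v (t *\<^sub>R axis i 1)) = f ((t *\<^sub>R axis i 1) $ i *\<^sub>R x)" for t
      by (simp add: matrix_vector_mult_scaleR A(2))
  qed (intro convex_on_compose_matrix f convex_on_coordinate[OF convex_on_ray])+
  finally show ?thesis .
qed

theorem radial_representation:
  obtains c \<nu> where "balanced_measure \<nu>"
    "\<And>f x. convex_on UNIV f \<Longrightarrow> \<Psi> f x = c + radial_integral \<nu> (\<lambda>s. f (s *\<^sub>R x))"
proof -
  obtain i :: 'n where "i \<in> UNIV" by blast
  interpret line_valuation "profile i" by (rule line_valuation_profile)
  have dilate: "convex_on UNIV (\<lambda>t. profile i (\<lambda>s. \<phi> (t * s)))" if \<phi>: "convex_on UNIV \<phi>" for \<phi>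
    unfolding profile_dilate[OF \<phi>]
  proof (rule convex_on_ray)
    show "convex_on UNIV (\<Psi> (\<lambda>z. \<phi> (z $ i)))"
      using funcset_mem[OF maps, of "\<lambda>z. \<phi> (z $ i)"] convex_on_coordinate[OF \<phi>, of i] by (simp add: Conv_iff)
  qed
  obtain \<nu> where \<nu>: "balanced_measure \<nu>"
    "\<And>\<phi>. convex_on UNIV \<phi> \<Longrightarrow> profile i \<phi> = profile i (\<lambda>_. 0) + radial_integral \<nu> \<phi>"
    using radial_representation[OF dilate] by blast
  interpret R: line_valuation "radial_integral \<nu>"
    using \<nu>(1) by (rule balanced_measure.line_valuation_radial_integral)
  have nonzero: "\<Psi> f x = profile i (\<lambda>_. 0) + radial_integral \<nu> (\<lambda>s. f (s *\<^sub>R x))"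
    if "convex_on UNIV f" "x \<noteq> 0" for f x
    using value_eq_profile[OF that, of i] \<nu>(2)[OF convex_on_ray[OF that(1), of x]] by simp
  \<comment> \<open>At the origin both sides are limits of their values along the axis.\<close>
  have "\<Psi> f 0 = profile i (\<lambda>_. 0) + radial_integral \<nu> (\<lambda>s. f (s *\<^sub>R 0))" if f: "convex_on UNIV f" for f
  proof -
    have inv: "(\<lambda>k. (1 / real (Suc k)) *\<^sub>R axis i 1) \<longlonglongrightarrow> (0 :: real ^ 'n)"
      using tendsto_scaleR[OF LIMSEQ_Suc[OF lim_1_over_n] tendsto_const, of "axis i 1"] by simp
    have cont: "isCont f x" for x
      by (rule convex_on_imp_isCont[OF f])
    have "(\<lambda>k. profile i (\<lambda>_. 0) + radial_integral \<nu> (\<lambda>s. f (s *\<^sub>R ((1 / real (Suc k)) *\<^sub>R axis i 1))))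
        \<longlonglongrightarrow> profile i (\<lambda>_. 0) + radial_integral \<nu> (\<lambda>s. f (s *\<^sub>R 0))"
      by (intro tendsto_add R.continuous convex_on_ray f isCont_tendsto_compose[OF cont] tendsto_scaleR inv tendsto_const)
    moreover have "(\<lambda>k. \<Psi> f ((1 / real (Suc k)) *\<^sub>R axis i 1)) \<longlonglongrightarrow> \<Psi> f 0"
      by (intro continuous_value f inv)
    moreover have "\<Psi> f ((1 / real (Suc k)) *\<^sub>R axis i 1) =
        profile i (\<lambda>_. 0) + radial_integral \<nu> (\<lambda>s. f (s *\<^sub>R ((1 / real (Suc k)) *\<^sub>R axis i 1)))" for k
      by (intro nonzero f) (simp add: axis_eq_0_iff del: of_nat_Suc)
    ultimately show ?thesis
      by (simp only: LIMSEQ_unique)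
  qed
  with nonzero have "\<Psi> f x = profile i (\<lambda>_. 0) + radial_integral \<nu> (\<lambda>s. f (s *\<^sub>R x))" if "convex_on UNIV f" for f x
    using that by (cases "x = 0") blast+
  with \<nu>(1) show thesis by (rule that)
qed

end

text \<open>
  Every property is inherited ray by ray from the one-dimensional radial integral.
\<close>

lemma SL_endomorphism_if_radial:
  fixes \<Psi> :: "(real ^ 'n \<Rightarrow> real) \<Rightarrow> (real ^ 'n \<Rightarrow> real)"
  assumes maps: "\<Psi> \<in> Conv \<rightarrow> Conv" and "balanced_measure \<nu>"
    and \<Psi>: "\<And>f x. convex_on UNIV f \<Longrightarrow> \<Psi> f x = c + radial_integral \<nu> (\<lambda>s. f (s *\<^sub>R x))"
  shows "continuous_map epi_topology epi_topology \<Psi>" "valuation \<Psi>"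
    "dually_epi_translation_invariant \<Psi>" "SL_equivariant \<Psi>"
proof -
  interpret line_valuation "radial_integral \<nu>"
    using assms(2) by (rule balanced_measure.line_valuation_radial_integral)
  show "continuous_map epi_topology epi_topology \<Psi>"
  proof (rule continuous_map_if_pointwise_limit[OF maps])
    fix F and f :: "real ^ 'n \<Rightarrow> real" and x
    assume *: "\<And>k. F k \<in> Conv" "f \<in> Conv" "\<And>z. (\<lambda>k. F k z) \<longlonglongrightarrow> f z"
    then have cv: "\<And>k. convex_on UNIV (F k)" "convex_on UNIV f"
      by (simp_all add: Conv_iff)
    show "(\<lambda>k. \<Psi> (F k) x) \<longlonglongrightarrow> \<Psi> f x"
      unfolding \<Psi>[OF cv(1)] \<Psi>[OF cv(2)] by (intro tendsto_intros continuous convex_on_ray cv *)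
  qed
  show "valuation \<Psi>"
    unfolding valuation_def Conv_iff
  proof (intro ballI impI allI; unfold Conv_iff)
    fix f h :: "real ^ 'n \<Rightarrow> real" and x
    assume cv: "convex_on UNIV f" "convex_on UNIV h" "convex_on UNIV (\<lambda>x. min (f x) (h x))"
    show "\<Psi> (\<lambda>y. max (f y) (h y)) x + \<Psi> (\<lambda>y. min (f y) (h y)) x = \<Psi> f x + \<Psi> h x"
      using valuation[OF convex_on_ray[OF cv(1)] convex_on_ray[OF cv(2)] convex_on_ray[OF cv(3)], of x]
      by (simp add: \<Psi> cv convex_on_max)
  qed
  show "dually_epi_translation_invariant \<Psi>"
    unfolding dually_epi_translation_invariant_def
  proof (intro ballI allI impI ext; unfold Conv_iff)
    fix f L :: "real ^ 'n \<Rightarrow> real" and b x assume f: "convex_on UNIV f" and L: "linear L"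
    have "convex_on UNIV (\<lambda>x. f x + (L x + b))"
      by (intro convex_on_add[OF f] convex_on_add[OF convex_on_linear[OF L]]) (simp add: convex_on_const)
    then show "\<Psi> (\<lambda>x. f x + (L x + b)) x = \<Psi> f x"
      using add_affine[OF convex_on_ray[OF f], of x "L x" b] by (simp add: \<Psi> f linear_scale[OF L] mult.commute)
  qed
  show "SL_equivariant \<Psi>"
    unfolding SL_equivariant_def
    by (auto simp: Conv_iff \<Psi> convex_on_compose_matrix matrix_vector_mult_scaleR)
qed

theorem theorem1:
  fixes \<Psi> :: "(real ^ 'n \<Rightarrow> real) \<Rightarrow> (real ^ 'n \<Rightarrow> real)"
  assumes "CARD('n) \<ge> 2"
    and "\<Psi> \<in> Conv \<rightarrow> Conv"
  shows "(continuous_map epi_topology epi_topology \<Psi> \<and> valuation \<Psi> \<and>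
          dually_epi_translation_invariant \<Psi> \<and> SL_equivariant \<Psi>)
     \<longleftrightarrow>
     (\<exists>(c :: real) \<nu>. \<nu> \<in> compactly_supported_measures \<and>
        (\<integral>\<^sup>+ s \<in> - {0}. ennreal (1 / \<bar>s\<bar>) \<partial>\<nu>) < \<infinity> \<and>
        (LINT s : - {0} | \<nu>. 1 / s) = 0 \<and>
        (\<forall>f\<in>Conv. \<forall>x. \<Psi> f x =
           c + (LINT s : - {0} | \<nu>. (f (s *\<^sub>R x) - f 0) / \<bar>s\<bar> ^ 2)))"
    (is "?L \<longleftrightarrow> ?R")
proof -
  have radial: "radial_integral \<nu> (\<lambda>s. f (s *\<^sub>R x)) = (LINT s : - {0} | \<nu>. (f (s *\<^sub>R x) - f 0) / \<bar>s\<bar> ^ 2)"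
    for \<nu> and f :: "real ^ 'n \<Rightarrow> real" and x
    by (simp add: radial_integral_def)
  have "?R \<longleftrightarrow> (\<exists>c \<nu>. balanced_measure \<nu> \<and>
      (\<forall>f x. convex_on UNIV f \<longrightarrow> \<Psi> f x = c + radial_integral \<nu> (\<lambda>s. f (s *\<^sub>R x))))"
    unfolding radial balanced_measure_def Conv_iff[symmetric] by blast
  also have "\<dots> \<longleftrightarrow> ?L"
  proof
    assume "\<exists>c \<nu>. balanced_measure \<nu> \<and>
      (\<forall>f x. convex_on UNIV f \<longrightarrow> \<Psi> f x = c + radial_integral \<nu> (\<lambda>s. f (s *\<^sub>R x)))"
    then show ?L
      using SL_endomorphism_if_radial[OF assms(2)] by blast
  next
    assume ?L
    then interpret SL_endomorphism \<Psi>
      using assms by unfold_locales auto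
    show "\<exists>c \<nu>. balanced_measure \<nu> \<and>
      (\<forall>f x. convex_on UNIV f \<longrightarrow> \<Psi> f x = c + radial_integral \<nu> (\<lambda>s. f (s *\<^sub>R x)))"
    proof (rule radial_representation)
      fix c \<nu>
      assume "balanced_measure \<nu>"
        "\<And>f x. convex_on UNIV f \<Longrightarrow> \<Psi> f x = c + radial_integral \<nu> (\<lambda>s. f (s *\<^sub>R x))"
      then show ?thesis by blast
    qed
  qed
  finally show ?thesis by blast
qed

end
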